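(* Let $G$ be a finitely generated solvable group. Then $F'$ consists of weak* identities in $G$ (i.e. modulo the trivial $T$-subgroup $\{1\}$).
   Context: Let $F$ be the free group on countably many generators $g_1,g_2,\dots$, and $F'=[F,F]$. For $N\ge 1$, $F^{\times N}$ is the direct product of $N$ copies of $F$, $i_k:F\to F^{\times N}$ the $k$-th inclusion. A subset $S\subset F$ is a set of weak identities in a group $G$ if there exists $N\ge1$ such that for any $s_1,\dots,s_N\in S$ and any homomorphism $\rho:F^{\times N}\to G$ some $k$ has $\rho(i_k(s_k))=1$. A $T$-subgroup of $F$ is a subgroup preserved by all endomorphisms of $F$. For a $T$-subgroup $\mathcal{H}$, $\mathcal{H}(G)=\{\pi(h):h\in\mathcal{H},\ \pi:F\to G\text{ a homomorphism}\}$. $S$ consists of weak identities modulo $\mathcal{H}$ in $G$ if $S$ is a set of weak identities in $G/\mathcal{H}(G)$. A $T$-subgroup $\mathcal{S}$ consists of weak* identities in $G$ modulo a $T$-subgroup $\mathcal{H}$ if there exist $m\ge0$ and $T$-subgroups $\mathcal{S}_0=\mathcal{S},\dots,\mathcal{S}_m=\mathcal{H}$ such that $\mathcal{S}_{j-1}$ consists of weak identities modulo $\mathcal{S}_j$ in $G$ for all $j=1,\dots,m$. *)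

theory Defs
  imports "HOL-Algebra.Algebra"
begin

text \<open>A word is a list of letters (i, b): (i, True) is the generator g_i and
  (i, False) its inverse.  Elements of F are the freely reduced words.\<close>

type_synonym fword = "(nat \<times> bool) list"

fun free_reduce :: "fword \<Rightarrow> fword" where
  "free_reduce [] = []"
| "free_reduce (x # xs) =
     (case free_reduce xs of
        [] \<Rightarrow> [x]
      | y # ys \<Rightarrow> (if fst x = fst y \<and> snd x \<noteq> snd y then ys else x # y # ys))"

definition freely_reduced :: "fword \<Rightarrow> bool" where
  "freely_reduced w \<longleftrightarrow> (\<forall>i. Suc i < length w \<longrightarrow>
      \<not> (fst (w ! i) = fst (w ! Suc i) \<and> snd (w ! i) \<noteq> snd (w ! Suc i)))"

definition freeF :: "fword monoid" where
  "freeF = \<lparr>carrier = {w. freely_reduced w},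
            monoid.mult = (\<lambda>x y. free_reduce (x @ y)),
            one = []\<rparr>"

definition freeF_pow :: "nat \<Rightarrow> (nat \<Rightarrow> fword) monoid" where
  "freeF_pow N = product_group {..<N} (\<lambda>_. freeF)"

definition incl :: "nat \<Rightarrow> nat \<Rightarrow> fword \<Rightarrow> (nat \<Rightarrow> fword)" where
  "incl N k x = (\<lambda>j\<in>{..<N}. if j = k then x else [])"

definition weak_identities :: "('a, 'b) monoid_scheme \<Rightarrow> fword set \<Rightarrow> bool" where
  "weak_identities G S \<longleftrightarrow>
     (\<exists>N\<ge>1. \<forall>s \<in> {..<N} \<rightarrow> S. \<forall>\<rho> \<in> hom (freeF_pow N) G.
         \<exists>k<N. \<rho> (incl N k (s k)) = \<one>\<^bsub>G\<^esub>)"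

definition T_subgroup :: "fword set \<Rightarrow> bool" where
  "T_subgroup H \<longleftrightarrow> subgroup H freeF \<and> (\<forall>\<phi> \<in> hom freeF freeF. \<phi> ` H \<subseteq> H)"

definition verbal :: "fword set \<Rightarrow> ('a, 'b) monoid_scheme \<Rightarrow> 'a set" where
  "verbal H G = {\<pi> h | h \<pi>. h \<in> H \<and> \<pi> \<in> hom freeF G}"

definition weak_identities_mod ::
    "('a, 'b) monoid_scheme \<Rightarrow> fword set \<Rightarrow> fword set \<Rightarrow> bool" where
  "weak_identities_mod G H S \<longleftrightarrow> weak_identities (G Mod (verbal H G)) S"

definition weak_star_identities_mod ::
    "('a, 'b) monoid_scheme \<Rightarrow> fword set \<Rightarrow> fword set \<Rightarrow> bool" where
  "weak_star_identities_mod G H S \<longleftrightarrow>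
     (\<exists>m::nat. \<exists>Ss :: nat \<Rightarrow> fword set.
        Ss 0 = S \<and> Ss m = H \<and> (\<forall>j\<le>m. T_subgroup (Ss j)) \<and>
        (\<forall>j\<in>{1..m}. weak_identities_mod G (Ss j) (Ss (j - 1))))"

definition finitely_generated :: "('a, 'b) monoid_scheme \<Rightarrow> bool" where
  "finitely_generated G \<longleftrightarrow> (\<exists>A. finite A \<and> A \<subseteq> carrier G \<and> generate G A = carrier G)"

end

(* The chain of T-subgroups consists of the derived series F' = F^(1), F^(2), ... of F up to the
   derived length of G, followed by {1}.  The step from F^(j) to F^(j+1) reduces to a statement
   about finitely generated metabelian groups: there is N such that among N pairwise commuting
   subgroups one is abelian.  Applied modulo the second derived subgroup it shows that one of the
   images H_k of F satisfies H_k' <= G'', whence H_k^(j) <= G^(j+1).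

   For a metabelian group G, M = G' is a Noetherian G-module (P. Hall), and Noetherian induction
   yields D such that for every n = 1 mod D, x in M and q in G: x^n = 1 implies x = 1, and if q^n
   centralizes x then so does q.  On the other hand, a pigeonhole argument in the finitely
   generated group G/M shows that among sufficiently many elements there is one with a power, of
   exponent 1 mod D, that is a product of powers of the others modulo M.  Doing this twice, with
   disjoint sets of other indices, gives for any a, b in some H_k powers of a and b that commute
   with each other and with x = [a, b].  So a and b commute with x, a power of x with exponent
   1 mod D is trivial, and therefore x = 1. *)

theory Submission
  imports Defs
begin

section \<open>The free group of reduced words\<close>

text \<open>Passing from x^n = 1 to x = 1, or from q^n to q, can fail through torsion in quotients
  of M and through powers q^e that act trivially on a section of M although q does not. Noetherian
  induction meets only finitely many such obstructing numbers; D is a product built from them, and n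
  = 1 mod D escapes all of them at once. The class of 1 modulo D is moreover closed under products,
  so [a^i, b^j] = [a, b]^(i j), valid once a and b commute with [a, b], still has an admissible
  exponent. The delicate point is that a^i = m u and b^j = m' u', with m, m' in M, must commute. The
  factors u and u' are products of elements with other indices, so they commute with a and b; m and
  m' commute because M is abelian. The mixed pair u, m' is settled by m' = b^j u'^-1, and for this u
  must commute with u', which is why the two sets of other indices have to be disjoint.\<close>

definition push :: "nat \<times> bool \<Rightarrow> fword \<Rightarrow> fword" where
  "push x r = (case r of [] \<Rightarrow> [x]
     | y # ys \<Rightarrow> (if fst x = fst y \<and> snd x \<noteq> snd y then ys else x # y # ys))"

lemma free_reduce_Cons: "free_reduce (x # xs) = push x (free_reduce xs)"
  by (simp add: push_def)

lemma freely_reduced_Nil [simp]: "freely_reduced []"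
  by (simp add: freely_reduced_def)

lemma freely_reduced_single [simp]: "freely_reduced [x]"
  by (simp add: freely_reduced_def)

lemma freely_reduced_Cons2:
  "freely_reduced (x # y # w) \<longleftrightarrow> \<not> (fst x = fst y \<and> snd x \<noteq> snd y) \<and> freely_reduced (y # w)"
proof -
  define P :: "fword \<Rightarrow> nat \<Rightarrow> bool" where "P = (\<lambda>v i. Suc i < length v \<longrightarrow>
    \<not> (fst (v ! i) = fst (v ! Suc i) \<and> snd (v ! i) \<noteq> snd (v ! Suc i)))"
  have "freely_reduced v \<longleftrightarrow> (\<forall>i. P v i)" for v
    by (simp only: freely_reduced_def P_def)
  moreover have "(\<forall>i. P (x # y # w) i) \<longleftrightarrow> P (x # y # w) 0 \<and> (\<forall>i. P (x # y # w) (Suc i))"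
    by (metis not0_implies_Suc)
  moreover have "P (x # y # w) 0 \<longleftrightarrow> \<not> (fst x = fst y \<and> snd x \<noteq> snd y)"
    unfolding P_def by auto
  moreover have "P (x # y # w) (Suc i) \<longleftrightarrow> P (y # w) i" for i
    by (simp only: P_def nth_Cons_Suc length_Cons Suc_less_eq)
  ultimately show ?thesis by simp
qed

lemma freely_reduced_ConsD: "freely_reduced (x # w) \<Longrightarrow> freely_reduced w"
  by (cases w) (auto simp: freely_reduced_Cons2)

lemma freely_reduced_push: "freely_reduced r \<Longrightarrow> freely_reduced (push x r)"
  by (cases r) (auto simp: push_def freely_reduced_Cons2 dest: freely_reduced_ConsD)

lemma freely_reduced_free_reduce [simp]: "freely_reduced (free_reduce w)"
  by (induction w) (auto simp: free_reduce_Cons freely_reduced_push simp del: free_reduce.simps(2))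

lemma push_reduced: "freely_reduced (x # w) \<Longrightarrow> push x w = x # w"
  by (cases w) (auto simp: push_def freely_reduced_Cons2)

lemma free_reduce_reduced [simp]: "freely_reduced w \<Longrightarrow> free_reduce w = w"
  by (induction w)
    (auto simp: free_reduce_Cons push_reduced freely_reduced_ConsD simp del: free_reduce.simps(2))

text \<open>Van der Waerden's device: on reduced words \<open>push (i, b)\<close> and
  \<open>push (i, \<not> b)\<close> are mutually inverse permutations. Associativity in the free
  group then comes from composing such permutations.\<close>

lemma push_cancel:
  assumes "freely_reduced r"
  shows "push (i, b) (push (i, \<not> b) r) = r"
proof (cases r)
  case (Cons y ys)
  show ?thesis
  proof (cases "y = (i, b)")
    case True
    with Cons assms have "push (i, b) ys = r" by (simp add: push_reduced)
    with True Cons show ?thesis by (simp add: push_def)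
  next
    case False
    then have "\<not> (i = fst y \<and> (\<not> b) \<noteq> snd y)" by (cases y) auto
    then have "push (i, \<not> b) r = (i, \<not> b) # r" unfolding Cons push_def by auto
    then show ?thesis by (simp add: push_def)
  qed
qed (simp add: push_def)

lemma free_reduce_append: "free_reduce (x @ y) = foldr push x (free_reduce y)"
  by (induction x) (auto simp: free_reduce_Cons simp del: free_reduce.simps(2))

lemma freely_reduced_foldr_push: "freely_reduced r \<Longrightarrow> freely_reduced (foldr push x r)"
  by (induction x) (auto intro: freely_reduced_push)

text \<open>If \<open>a\<close> cancels the head of \<open>w\<close>, the word loses a pair of
  inverse letters, and the two permutations belonging to them cancel by \<open>push_cancel\<close>.
  Otherwise both sides are the same fold.\<close>

lemma foldr_push_push:
  assumes "freely_reduced r"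
  shows "foldr push (push a w) r = push a (foldr push w r)"
proof (cases w)
  case (Cons y ys)
  show ?thesis
  proof (cases "fst a = fst y \<and> snd a \<noteq> snd y")
    case True
    then have "y = (fst a, \<not> snd a)" by (cases a; cases y) auto
    then show ?thesis
      using Cons push_cancel[OF freely_reduced_foldr_push[OF assms], of "fst a" "snd a" ys]
      by (simp add: push_def)
  qed (use Cons in \<open>auto simp: push_def\<close>)
qed (simp add: push_def)

lemma foldr_push_free_reduce:
  assumes "freely_reduced r"
  shows "foldr push (free_reduce w) r = foldr push w r"
  by (induction w) (simp_all add: free_reduce_Cons foldr_push_push assms del: free_reduce.simps(2))

text \<open>Reducing a factor does not change the permutation that it induces; the associative law
  of \<open>freeF\<close> is a consequence.\<close>

lemma free_reduce_absorb [simp]: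
  "free_reduce (free_reduce x @ y) = free_reduce (x @ y)"
  "free_reduce (x @ free_reduce y) = free_reduce (x @ y)"
  by (simp_all add: free_reduce_append foldr_push_free_reduce)

definition word_inv :: "fword \<Rightarrow> fword" where
  "word_inv w = rev (map (\<lambda>(i, b). (i, \<not> b)) w)"

text \<open>The suffix \<open>v\<close> carries the induction: the innermost pair of inverse letters
  cancels while further letters still stand to its right.\<close>

lemma free_reduce_inv_append: "free_reduce (word_inv w @ w @ v) = free_reduce v"
proof (induction w arbitrary: v)
  case (Cons a w)
  obtain i b where a: "a = (i, b)" by (cases a)
  have "free_reduce (word_inv (a # w) @ (a # w) @ v)
      = foldr push (word_inv w) (push (i, \<not> b) (push (i, \<not> \<not> b) (free_reduce (w @ v))))"
    by (simp add: a word_inv_def free_reduce_append free_reduce_Cons del: free_reduce.simps(2))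
  also have "\<dots> = free_reduce (word_inv w @ w @ v)"
    by (simp only: push_cancel[OF freely_reduced_free_reduce] free_reduce_append[of "word_inv w"])
  finally show ?case using Cons by simp
qed (simp add: word_inv_def)

lemma carrier_freeF: "carrier freeF = {w. freely_reduced w}"
  and mult_freeF: "x \<otimes>\<^bsub>freeF\<^esub> y = free_reduce (x @ y)"
  and one_freeF: "\<one>\<^bsub>freeF\<^esub> = []"
  by (simp_all add: freeF_def)

lemma group_freeF: "group freeF"
proof (rule groupI)
  fix x assume "x \<in> carrier freeF"
  show "\<exists>y\<in>carrier freeF. y \<otimes>\<^bsub>freeF\<^esub> x = \<one>\<^bsub>freeF\<^esub>"
    using free_reduce_inv_append[of x "[]"]
    by (intro bexI[of _ "free_reduce (word_inv x)"]) (simp_all add: carrier_freeF mult_freeF one_freeF)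
qed (auto simp: carrier_freeF mult_freeF one_freeF)

definition gen :: "nat \<Rightarrow> fword" where
  "gen i = [(i, True)]"

lemma gen_in_carrier [simp]: "gen i \<in> carrier freeF"
  by (simp add: gen_def carrier_freeF)

lemma inv_gen: "inv\<^bsub>freeF\<^esub> gen i = [(i, False)]"
  by (rule group.inv_equality[OF group_freeF]) (auto simp: gen_def carrier_freeF mult_freeF one_freeF)

section \<open>Evaluation of words and the universal property of the free group\<close>

fun eval_word :: "('a, 'b) monoid_scheme \<Rightarrow> (nat \<Rightarrow> 'a) \<Rightarrow> fword \<Rightarrow> 'a" where
  "eval_word G f [] = \<one>\<^bsub>G\<^esub>"
| "eval_word G f (x # w) = (if snd x then f (fst x) else inv\<^bsub>G\<^esub> f (fst x)) \<otimes>\<^bsub>G\<^esub> eval_word G f w"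

context group
begin

lemma eval_word_closed [simp]: "range f \<subseteq> carrier G \<Longrightarrow> eval_word G f w \<in> carrier G"
  by (induction w) (auto intro!: m_closed simp: subset_iff)

lemma eval_word_append:
  "range f \<subseteq> carrier G \<Longrightarrow> eval_word G f (v @ w) = eval_word G f v \<otimes> eval_word G f w"
  by (induction v) (auto simp: m_assoc subset_iff)

lemma eval_word_push:
  assumes "range f \<subseteq> carrier G"
  shows "eval_word G f (push x w) = eval_word G f (x # w)"
proof (cases w)
  case (Cons y ys)
  have "f i \<in> carrier G" for i using assms by auto
  then show ?thesis
    using Cons assms by (cases x; cases y) (auto simp: push_def m_assoc[symmetric])
qed (simp add: push_def)

lemma eval_word_free_reduce:
  "range f \<subseteq> carrier G \<Longrightarrow> eval_word G f (free_reduce w) = eval_word G f w"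
  by (induction w) (simp_all add: free_reduce_Cons eval_word_push del: free_reduce.simps(2))

lemma eval_word_hom: "range f \<subseteq> carrier G \<Longrightarrow> eval_word G f \<in> hom freeF G"
  by (intro homI) (simp_all add: mult_freeF eval_word_free_reduce eval_word_append)

lemma eval_word_gen: "range f \<subseteq> carrier G \<Longrightarrow> eval_word G f (gen i) = f i"
  by (simp add: gen_def image_subset_iff)

end

lemma hom_freeF_eq:
  assumes G: "group G" and \<rho>: "\<rho> \<in> hom freeF G" and \<sigma>: "\<sigma> \<in> hom freeF G"
    and eq: "\<And>i. \<rho> (gen i) = \<sigma> (gen i)" and w: "w \<in> carrier freeF"
  shows "\<rho> w = \<sigma> w"
proof -
  interpret R: group_hom freeF G \<rho>
    by (intro group_hom.intro group_hom_axioms.intro group_freeF G \<rho>)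
  interpret S: group_hom freeF G \<sigma>
    by (intro group_hom.intro group_hom_axioms.intro group_freeF G \<sigma>)
  have "freely_reduced w" using w by (simp add: carrier_freeF)
  then show ?thesis
  proof (induction w)
    case Nil
    then show ?case using R.hom_one S.hom_one by (simp add: one_freeF)
  next
    case (Cons a w)
    then have w: "w \<in> carrier freeF" and a: "[a] \<in> carrier freeF"
      by (auto simp: carrier_freeF dest: freely_reduced_ConsD)
    have "\<rho> [a] = \<sigma> [a]"
    proof (cases a)
      case (Pair i b)
      show ?thesis
      proof (cases b)
        case True
        then show ?thesis using eq[of i] Pair by (simp add: gen_def)
      next
        case False
        then show ?thesis using Pair eq[of i] R.hom_inv[of "gen i"] S.hom_inv[of "gen i"]
          by (simp add: inv_gen)
      qed
    qed
    moreover have "a # w = [a] \<otimes>\<^bsub>freeF\<^esub> w"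
      using Cons.prems by (simp only: mult_freeF append.simps free_reduce_reduced)
    moreover have "\<rho> w = \<sigma> w"
      using Cons by (blast dest: freely_reduced_ConsD)
    ultimately show ?case
      using R.hom_mult[OF a w] S.hom_mult[OF a w] by simp
  qed
qed

text \<open>Sending the generators of two copies of F to the even and to the odd generators makes
  the variables of two words disjoint, so any two homomorphisms are restrictions of one.\<close>

lemma freeF_join:
  assumes G: "group G" and p: "p \<in> hom freeF G" and q: "q \<in> hom freeF G"
  obtains \<phi> \<psi> \<pi> where "\<phi> \<in> hom freeF freeF" "\<psi> \<in> hom freeF freeF" "\<pi> \<in> hom freeF G"
    "\<And>w. w \<in> carrier freeF \<Longrightarrow> \<pi> (\<phi> w) = p w" "\<And>w. w \<in> carrier freeF \<Longrightarrow> \<pi> (\<psi> w) = q w"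
proof -
  define \<phi> where "\<phi> = eval_word freeF (\<lambda>i. gen (2 * i))"
  define \<psi> where "\<psi> = eval_word freeF (\<lambda>i. gen (2 * i + 1))"
  define f where "f = (\<lambda>i. if even i then p (gen (i div 2)) else q (gen (i div 2)))"
  define \<pi> where "\<pi> = eval_word G f"
  interpret F: group freeF by (rule group_freeF)
  interpret G: group G by (rule G)
  have f: "range f \<subseteq> carrier G"
    using hom_in_carrier[OF p] hom_in_carrier[OF q] by (auto simp: f_def)
  have \<phi>: "\<phi> \<in> hom freeF freeF" and \<psi>: "\<psi> \<in> hom freeF freeF" and \<pi>: "\<pi> \<in> hom freeF G"
    unfolding \<phi>_def \<psi>_def \<pi>_def using f by (auto intro!: F.eval_word_hom G.eval_word_hom)
  have "\<pi> (\<phi> (gen i)) = p (gen i)" "\<pi> (\<psi> (gen i)) = q (gen i)" for i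
    unfolding \<phi>_def \<psi>_def \<pi>_def
    by (subst F.eval_word_gen, force, subst G.eval_word_gen, rule f, simp add: f_def)+
  then have gens: "(\<pi> \<circ> \<phi>) (gen i) = p (gen i)" "(\<pi> \<circ> \<psi>) (gen i) = q (gen i)" for i
    by simp_all
  have "(\<pi> \<circ> \<phi>) w = p w" "(\<pi> \<circ> \<psi>) w = q w" if "w \<in> carrier freeF" for w
    by (rule hom_freeF_eq[OF G hom_compose[OF \<phi> \<pi>] p gens(1) that],
        rule hom_freeF_eq[OF G hom_compose[OF \<psi> \<pi>] q gens(2) that])
  then show ?thesis
    by (intro that[OF \<phi> \<psi> \<pi>]) simp_all
qed

section \<open>Noetherian modules\<close>

text \<open>Formulated for any family of sets, since it serves both for invariant subgroups of a
  module and for subgroups containing a given one.\<close>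

definition acc :: "'a set set \<Rightarrow> bool" where
  "acc \<F> \<longleftrightarrow> (\<forall>f :: nat \<Rightarrow> 'a set. (\<forall>i. f i \<in> \<F>) \<and> (\<forall>i. f i \<subseteq> f (Suc i)) \<longrightarrow>
      (\<exists>n. \<forall>m\<ge>n. f m = f n))"

lemma accD:
  assumes "acc \<F>" "\<And>i :: nat. f i \<in> \<F>" "\<And>i. f i \<subseteq> f (Suc i)"
  shows "\<exists>n. \<forall>m\<ge>n. f m = f n"
  using assms unfolding acc_def by simp

lemma acc_subset: "acc \<F> \<Longrightarrow> \<G> \<subseteq> \<F> \<Longrightarrow> acc \<G>"
  unfolding acc_def by (meson subsetD)

lemma acc_maximal:
  assumes "acc \<F>" "\<A> \<subseteq> \<F>" "\<A> \<noteq> {}"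
  shows "\<exists>B\<in>\<A>. \<forall>C\<in>\<A>. B \<subseteq> C \<longrightarrow> C = B"
proof (rule ccontr)
    assume "\<not> ?thesis"
    then have *: "\<forall>B\<in>\<A>. \<exists>C\<in>\<A>. B \<subset> C" by blast
    obtain A where A: "A \<in> \<A>" using assms(3) by blast
    obtain g where g: "\<And>B. B \<in> \<A> \<Longrightarrow> g B \<in> \<A> \<and> B \<subset> g B" using * by metis
    define f where "f = (\<lambda>n. (g ^^ n) A)"
    have f: "f n \<in> \<A>" for n by (induction n) (auto simp: f_def A g)
    have step: "f n \<subset> f (Suc n)" for n using g[OF f[of n]] by (simp add: f_def)
    have "f n \<in> \<F>" for n using f assms(2) by (rule subsetD[rotated])
    moreover have "f n \<subseteq> f (Suc n)" for n using step[of n] by (rule psubset_imp_subset)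
    ultimately have "\<exists>n. \<forall>m\<ge>n. f m = f n"
      by (rule accD[OF assms(1)])
    then obtain n where "\<forall>m\<ge>n. f m = f n" ..
    then have "f (Suc n) = f n" by (meson lessI less_imp_le)
    with step[of n] show False by simp
qed

lemma acc_induct [consumes 2, case_names step]:
  assumes "acc \<F>" "A \<in> \<F>"
    and step: "\<And>B. B \<in> \<F> \<Longrightarrow> (\<And>C. C \<in> \<F> \<Longrightarrow> B \<subset> C \<Longrightarrow> P C) \<Longrightarrow> P B"
  shows "P A"
proof (rule ccontr)
  assume "\<not> P A"
  define \<A> where "\<A> = {B \<in> \<F>. \<not> P B}"
  have "\<A> \<noteq> {}" "\<A> \<subseteq> \<F>" using assms(2) \<open>\<not> P A\<close> by (auto simp: \<A>_def)
  then obtain B where B: "B \<in> \<A>" and max: "\<forall>C\<in>\<A>. B \<subseteq> C \<longrightarrow> C = B"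
    using acc_maximal[OF assms(1)] by meson
  have "P B"
  proof (rule step)
    fix C assume "C \<in> \<F>" "B \<subset> C"
    then show "P C" using max by (auto simp: \<A>_def)
  qed (use B in \<open>simp add: \<A>_def\<close>)
  with B show False by (simp add: \<A>_def)
qed

text \<open>Submodules over the ring generated by the operators in \<Gamma>, encoded without that
  ring. For empty \<Gamma> they are plain subgroups. A larger \<Gamma> gives a smaller family, so
  \<open>acc\<close> passes to larger sets of operators.\<close>

definition inv_subgroups :: "('a, 'b) monoid_scheme \<Rightarrow> ('a \<Rightarrow> 'a) set \<Rightarrow> 'a set \<Rightarrow> 'a set set" where
  "inv_subgroups G \<Gamma> A = {B. subgroup B G \<and> B \<subseteq> A \<and> (\<forall>f\<in>\<Gamma>. f ` B \<subseteq> B)}"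

lemma inv_subgroups_image: "B \<in> inv_subgroups G \<Gamma> A \<Longrightarrow> f \<in> \<Gamma> \<Longrightarrow> x \<in> B \<Longrightarrow> f x \<in> B"
  unfolding inv_subgroups_def by blast

lemma inv_subgroups_antimono: "\<Gamma> \<subseteq> \<Delta> \<Longrightarrow> inv_subgroups G \<Delta> A \<subseteq> inv_subgroups G \<Gamma> A"
  unfolding inv_subgroups_def by blast

section \<open>Leading coefficients, sums of Noetherian modules and Hilbert's basis theorem\<close>

context comm_group
begin

text \<open>In additive terms tA + R. With a power of an operator for \<open>t\<close> and the span
  of the lower powers for R, this models polynomials of bounded degree.\<close>

definition shifted_sum :: "('a \<Rightarrow> 'a) \<Rightarrow> 'a set \<Rightarrow> 'a set \<Rightarrow> 'a set" where
  "shifted_sum t A R = {t a \<otimes> r | a r. a \<in> A \<and> r \<in> R}"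

text \<open>The leading coefficients of the elements t a + r of B. An element may have several,
  since \<open>t\<close> can have a kernel and tA can meet R; hence the existential form.\<close>

definition lead :: "('a \<Rightarrow> 'a) \<Rightarrow> 'a set \<Rightarrow> 'a set \<Rightarrow> 'a set \<Rightarrow> 'a set" where
  "lead t A R B = {a \<in> A. \<exists>r\<in>R. t a \<otimes> r \<in> B}"

lemma shifted_sum_inv_subgroups:
  assumes t: "t \<in> hom G G" and \<Gamma>: "\<Gamma> \<subseteq> hom G G"
    and comm: "\<And>f x. f \<in> \<Gamma> \<Longrightarrow> x \<in> carrier G \<Longrightarrow> f (t x) = t (f x)"
    and A: "A \<in> inv_subgroups G \<Gamma> (carrier G)" and R: "R \<in> inv_subgroups G \<Gamma> (carrier G)"
  shows "shifted_sum t A R \<in> inv_subgroups G \<Gamma> (carrier G)"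
proof -
  interpret T: group_hom G G t by unfold_locales (rule t)
  have sA: "subgroup A G" and sR: "subgroup R G" using A R by (auto simp: inv_subgroups_def)
  interpret A: subgroup A G by (rule sA)
  interpret R: subgroup R G by (rule sR)
  have "subgroup (shifted_sum t A R) G"
  proof (rule subgroupI)
    show "shifted_sum t A R \<subseteq> carrier G" by (auto simp: shifted_sum_def)
    have "t \<one> \<otimes> \<one> \<in> shifted_sum t A R"
      unfolding shifted_sum_def using A.one_closed R.one_closed by blast
    then show "shifted_sum t A R \<noteq> {}" by blast
  next
    fix x assume "x \<in> shifted_sum t A R"
    then obtain a r where "x = t a \<otimes> r" "a \<in> A" "r \<in> R" by (auto simp: shifted_sum_def)
    then have "inv x = t (inv a) \<otimes> inv r" by (simp add: inv_mult)
    then show "inv x \<in> shifted_sum t A R"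
      unfolding shifted_sum_def using A.m_inv_closed[OF \<open>a \<in> A\<close>] R.m_inv_closed[OF \<open>r \<in> R\<close>] by blast
  next
    fix x y assume "x \<in> shifted_sum t A R" "y \<in> shifted_sum t A R"
    then obtain a r a' r' where "x = t a \<otimes> r" "a \<in> A" "r \<in> R" "y = t a' \<otimes> r'" "a' \<in> A" "r' \<in> R"
      by (auto simp: shifted_sum_def)
    moreover from this have "x \<otimes> y = t (a \<otimes> a') \<otimes> (r \<otimes> r')" by (simp add: m_ac)
    ultimately show "x \<otimes> y \<in> shifted_sum t A R"
      unfolding shifted_sum_def using A.m_closed R.m_closed by blast
  qed
  moreover have "f x \<in> shifted_sum t A R" if "f \<in> \<Gamma>" "x \<in> shifted_sum t A R" for f x
  proof -
    obtain a r where x: "x = t a \<otimes> r" "a \<in> A" "r \<in> R" using \<open>x \<in> shifted_sum t A R\<close> by (auto simp: shifted_sum_def)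
    interpret F: group_hom G G f by unfold_locales (rule subsetD[OF \<Gamma> that(1)])
    have "f x = t (f a) \<otimes> f r" using x comm[OF that(1)] by simp
    moreover have "f a \<in> A" "f r \<in> R" using inv_subgroups_image[OF A that(1)] inv_subgroups_image[OF R that(1)] x by simp_all
    ultimately show ?thesis by (auto simp: shifted_sum_def)
  qed
  ultimately show ?thesis by (auto simp: inv_subgroups_def dest: subgroup.subset)
qed

lemma lead_inv_subgroups:
  assumes t: "t \<in> hom G G" and \<Gamma>: "\<Gamma> \<subseteq> hom G G"
    and comm: "\<And>f x. f \<in> \<Gamma> \<Longrightarrow> x \<in> carrier G \<Longrightarrow> f (t x) = t (f x)"
    and A: "A \<in> inv_subgroups G \<Gamma> (carrier G)" and R: "R \<in> inv_subgroups G \<Gamma> (carrier G)"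
    and B: "B \<in> inv_subgroups G \<Gamma> (carrier G)"
  shows "lead t A R B \<in> inv_subgroups G \<Gamma> A"
proof -
  interpret T: group_hom G G t by unfold_locales (rule t)
  have sA: "subgroup A G" and sR: "subgroup R G" and sB: "subgroup B G"
    using A R B by (auto simp: inv_subgroups_def)
  interpret A: subgroup A G by (rule sA)
  interpret R: subgroup R G by (rule sR)
  interpret B: subgroup B G by (rule sB)
  have "subgroup (lead t A R B) G"
  proof (rule subgroupI)
    show "lead t A R B \<subseteq> carrier G" by (auto simp: lead_def)
    have "t \<one> \<otimes> \<one> \<in> B" by simp
    then have "\<one> \<in> lead t A R B"
      unfolding lead_def using A.one_closed R.one_closed by blast
    then show "lead t A R B \<noteq> {}" by blast
  next
    fix x assume "x \<in> lead t A R B"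
    then obtain r where x: "x \<in> A" "r \<in> R" "t x \<otimes> r \<in> B" by (auto simp: lead_def)
    then have "inv (t x \<otimes> r) \<in> B" by blast
    then have "t (inv x) \<otimes> inv r \<in> B" using x by (simp add: inv_mult)
    then show "inv x \<in> lead t A R B" using x unfolding lead_def by blast
  next
    fix x y assume "x \<in> lead t A R B" "y \<in> lead t A R B"
    then obtain r r' where x: "x \<in> A" "r \<in> R" "t x \<otimes> r \<in> B" "y \<in> A" "r' \<in> R" "t y \<otimes> r' \<in> B"
      by (auto simp: lead_def)
    then have "(t x \<otimes> r) \<otimes> (t y \<otimes> r') \<in> B" by blast
    then have "t (x \<otimes> y) \<otimes> (r \<otimes> r') \<in> B" using x by (simp add: m_ac)
    then show "x \<otimes> y \<in> lead t A R B" using x unfolding lead_def by blast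
  qed
  moreover have "f x \<in> lead t A R B" if "f \<in> \<Gamma>" "x \<in> lead t A R B" for f x
  proof -
    obtain r where x: "x \<in> A" "r \<in> R" "t x \<otimes> r \<in> B"
      using \<open>x \<in> lead t A R B\<close> by (auto simp: lead_def)
    interpret F: group_hom G G f by unfold_locales (rule subsetD[OF \<Gamma> that(1)])
    have "f (t x \<otimes> r) \<in> B" by (rule inv_subgroups_image[OF B that(1) x(3)])
    then have "t (f x) \<otimes> f r \<in> B" using x comm[OF that(1)] by simp
    moreover have "f x \<in> A" "f r \<in> R" using inv_subgroups_image[OF A that(1)] inv_subgroups_image[OF R that(1)] x by simp_all
    ultimately show ?thesis by (auto simp: lead_def)
  qed
  ultimately show ?thesis by (auto simp: inv_subgroups_def lead_def)
qed

lemma lead_mono: "B \<subseteq> C \<Longrightarrow> lead t A R B \<subseteq> lead t A R C"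
  by (auto simp: lead_def)

text \<open>An element t a + r of C shares its leading coefficient with some t a + r' of B. The
  difference r - r' lies in C and in R, hence in B.\<close>

lemma lead_determines:
  assumes t: "t \<in> hom G G" and sub: "A \<subseteq> carrier G" "subgroup R G" "subgroup B G" "subgroup C G"
    and BC: "B \<subseteq> C" and R: "C \<inter> R \<subseteq> B" and lead: "lead t A R C \<subseteq> lead t A R B"
  shows "C \<inter> shifted_sum t A R \<subseteq> B"
proof
  interpret T: group_hom G G t by unfold_locales (rule t)
  interpret R: subgroup R G by (rule sub)
  interpret B: subgroup B G by (rule sub)
  interpret C: subgroup C G by (rule sub)
  fix x assume "x \<in> C \<inter> shifted_sum t A R"
  then obtain a r where x: "x \<in> C" "x = t a \<otimes> r" "a \<in> A" "r \<in> R" by (auto simp: shifted_sum_def)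
  then have "a \<in> lead t A R B" using lead by (auto simp: lead_def)
  then obtain r' where r': "r' \<in> R" "t a \<otimes> r' \<in> B" by (auto simp: lead_def)
  have a: "t a \<in> carrier G" using x sub by auto
  have "x \<otimes> inv (t a \<otimes> r') = r \<otimes> (t a \<otimes> inv (t a)) \<otimes> inv r'"
    using x r' a by (simp add: inv_mult m_ac)
  also have "\<dots> = r \<otimes> inv r'"
    using x r' a by simp
  finally have "x \<otimes> inv (t a \<otimes> r') \<in> R"
    using x r' by simp
  moreover have "x \<otimes> inv (t a \<otimes> r') \<in> C"
    using x(1) r'(2) BC by blast
  ultimately have "x \<otimes> inv (t a \<otimes> r') \<in> B" using R by blast
  then have "x \<otimes> inv (t a \<otimes> r') \<otimes> (t a \<otimes> r') \<in> B" using r' by blast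
  then show "x \<in> B" using x r' a inv_closed by (simp add: m_assoc del: inv_mult)
qed

text \<open>A chain becomes constant as soon as both its leading coefficients in A and its
  intersections with R do. With the identity for \<open>t\<close> it follows that a sum of two
  Noetherian modules is Noetherian.\<close>

lemma acc_shifted_sum:
  assumes t: "t \<in> hom G G" and \<Gamma>: "\<Gamma> \<subseteq> hom G G"
    and comm: "\<And>f x. f \<in> \<Gamma> \<Longrightarrow> x \<in> carrier G \<Longrightarrow> f (t x) = t (f x)"
    and A: "A \<in> inv_subgroups G \<Gamma> (carrier G)" and R: "R \<in> inv_subgroups G \<Gamma> (carrier G)"
    and accA: "acc (inv_subgroups G \<Gamma> A)" and accR: "acc (inv_subgroups G \<Gamma> R)"
  shows "acc (inv_subgroups G \<Gamma> (shifted_sum t A R))"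
  unfolding acc_def
proof (intro allI impI, elim conjE)
  fix f :: "nat \<Rightarrow> 'a set"
  assume f: "\<forall>i. f i \<in> inv_subgroups G \<Gamma> (shifted_sum t A R)" and mono: "\<forall>i. f i \<subseteq> f (Suc i)"
  have E: "shifted_sum t A R \<subseteq> carrier G"
    using shifted_sum_inv_subgroups[OF t \<Gamma> comm A R] by (auto simp: inv_subgroups_def)
  have f': "f i \<in> inv_subgroups G \<Gamma> (carrier G)" for i
    using f E by (fastforce simp: inv_subgroups_def)
  have mono': "i \<le> j \<Longrightarrow> f i \<subseteq> f j" for i j
    using mono by (simp add: lift_Suc_mono_le)
  have "lead t A R (f i) \<subseteq> lead t A R (f (Suc i))" for i
    using mono by (intro lead_mono) simp
  with lead_inv_subgroups[OF t \<Gamma> comm A R f']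
  have "\<exists>n. \<forall>m\<ge>n. lead t A R (f m) = lead t A R (f n)"
    by (rule accD[OF accA])
  then obtain n1 where n1: "\<forall>m\<ge>n1. lead t A R (f m) = lead t A R (f n1)" ..
  have "f i \<inter> R \<in> inv_subgroups G \<Gamma> R" for i
    using f'[of i] R unfolding inv_subgroups_def by (blast intro: subgroups_Inter_pair)
  moreover have "f i \<inter> R \<subseteq> f (Suc i) \<inter> R" for i using mono by blast
  ultimately have "\<exists>n. \<forall>m\<ge>n. f m \<inter> R = f n \<inter> R"
    by (rule accD[OF accR])
  then obtain n2 where n2: "\<forall>m\<ge>n2. f m \<inter> R = f n2 \<inter> R" ..
  have "f m = f (max n1 n2)" if m: "m \<ge> max n1 n2" for m
  proof
    have "f m \<inter> shifted_sum t A R \<subseteq> f (max n1 n2)"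
    proof (rule lead_determines[OF t])
      show "A \<subseteq> carrier G" "subgroup R G" "subgroup (f (max n1 n2)) G" "subgroup (f m) G"
        using A R f by (auto simp: inv_subgroups_def)
      show "f (max n1 n2) \<subseteq> f m" using mono' m by blast
      have "f m \<inter> R = f (max n1 n2) \<inter> R"
        using n2[rule_format, of m] n2[rule_format, of "max n1 n2"] m by simp
      then show "f m \<inter> R \<subseteq> f (max n1 n2)" by blast
      show "lead t A R (f m) \<subseteq> lead t A R (f (max n1 n2))"
        using n1[rule_format, of m] n1[rule_format, of "max n1 n2"] m by simp
    qed
    moreover have "f m \<subseteq> shifted_sum t A R" using f by (auto simp: inv_subgroups_def)
    ultimately show "f m \<subseteq> f (max n1 n2)" by blast
    show "f (max n1 n2) \<subseteq> f m" using mono' m by blast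
  qed
  then show "\<exists>n. \<forall>m\<ge>n. f m = f n" by blast
qed

text \<open>If a positive power of c occurs anywhere in the chain, take the least such exponent n
  over all members. From the stage where c^n occurs, division with remainder shows that every member
  consists of powers of c^n. If none occurs, all members are trivial.\<close>

lemma acc_cyclic:
  assumes c: "c \<in> carrier G"
  shows "acc (inv_subgroups G {} (generate G {c}))"
  unfolding acc_def
proof (intro allI impI, elim conjE)
  fix f :: "nat \<Rightarrow> 'a set"
  assume f: "\<forall>i. f i \<in> inv_subgroups G {} (generate G {c})" and mono: "\<forall>i. f i \<subseteq> f (Suc i)"
  have sub: "subgroup (f i) G" and gen: "f i \<subseteq> generate G {c}" for i
    using f by (auto simp: inv_subgroups_def)
  have power: "\<exists>z :: int. x = c [^] z" if "x \<in> f i" for x i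
    using gen[of i] that generate_pow[OF c] by blast
  have mono': "i \<le> j \<Longrightarrow> f i \<subseteq> f j" for i j
    using mono by (simp add: lift_Suc_mono_le)
  show "\<exists>n. \<forall>m\<ge>n. f m = f n"
  proof (cases "\<exists>n :: nat. n > 0 \<and> (\<exists>i. c [^] n \<in> f i)")
    case True
    define n where "n = (LEAST n :: nat. n > 0 \<and> (\<exists>i. c [^] n \<in> f i))"
    have n: "n > 0 \<and> (\<exists>i. c [^] n \<in> f i)"
      unfolding n_def by (rule LeastI_ex[OF True])
    then obtain i where i: "c [^] n \<in> f i" by blast
    have least: "\<not> (k > 0 \<and> c [^] k \<in> f j)" if "k < n" for k :: nat and j
      using not_less_Least[OF that[unfolded n_def]] by blast
    have "f m \<subseteq> f i" if m: "m \<ge> i" for m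
    proof
      fix x assume x: "x \<in> f m"
      obtain z :: int where z: "x = c [^] z" using power[OF x] by blast
      have nm: "c [^] n \<in> f m" using i mono'[OF m] by blast
      have pow: "(c [^] n) [^] q = c [^] (int n * q)" for q :: int
        using c by (simp add: int_pow_int[symmetric] int_pow_pow)
      have "(c [^] n) [^] (- (z div int n)) \<in> f m"
        by (rule subgroup_int_pow_closed[OF sub nm])
      then have "x \<otimes> (c [^] n) [^] (- (z div int n)) \<in> f m"
        using subgroup.m_closed[OF sub x] by blast
      also have "x \<otimes> (c [^] n) [^] (- (z div int n)) = c [^] (z + int n * (- (z div int n)))"
        unfolding pow z using c by (simp only: int_pow_mult)
      also have "z + int n * (- (z div int n)) = int (nat (z mod int n))"
        using n by (simp add: minus_mult_div_eq_mod)
      finally have "c [^] nat (z mod int n) \<in> f m"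
        by (simp only: int_pow_int)
      moreover have "nat (z mod int n) < n"
        using n by (simp add: nat_less_iff)
      ultimately have "nat (z mod int n) = 0"
        using least[of "nat (z mod int n)" m] by simp
      moreover have "z mod int n \<ge> 0" using n by simp
      ultimately have "z mod int n = 0" by linarith
      then have "z = int n * (z div int n)" using mult_div_mod_eq[of "int n" z] by simp
      then have "x = (c [^] n) [^] (z div int n)" unfolding pow z by simp
      then show "x \<in> f i" using subgroup_int_pow_closed[OF sub i] by simp
    qed
    then have "\<forall>m\<ge>i. f m = f i" using mono'[of i] by (simp add: subset_antisym)
    then show ?thesis ..
  next
    case False
    have "f m = {\<one>}" for m
    proof (rule ccontr)
      assume "f m \<noteq> {\<one>}"
      then obtain x where x: "x \<in> f m" "x \<noteq> \<one>" using subgroup.one_closed[OF sub[of m]] by blast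
      obtain z :: int where z: "x = c [^] z" using power[OF x(1)] by blast
      with x(2) have "z \<noteq> 0" by auto
      have "c [^] nat \<bar>z\<bar> \<in> f m"
      proof (cases "z \<ge> 0")
        case True
        then show ?thesis using x z c by (simp add: pow_nat)
      next
        case neg: False
        have "inv x \<in> f m" by (rule subgroup.m_inv_closed[OF sub x(1)])
        also have "inv x = c [^] int (nat \<bar>z\<bar>)"
          using neg z c by (simp add: int_pow_neg)
        finally show ?thesis by (simp only: int_pow_int)
      qed
      moreover have "nat \<bar>z\<bar> > 0" using \<open>z \<noteq> 0\<close> by simp
      ultimately show False using False by blast
    qed
    then show ?thesis by simp
  qed
qed

text \<open>Polynomials in \<open>t\<close> of degree less than \<open>n\<close> with coefficients
  in A: the summand added at \<open>Suc n\<close> has degree \<open>n\<close>.\<close>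

primrec power_span :: "('a \<Rightarrow> 'a) \<Rightarrow> 'a set \<Rightarrow> nat \<Rightarrow> 'a set" where
  "power_span t A 0 = {\<one>}"
| "power_span t A (Suc n) = shifted_sum (t ^^ n) A (power_span t A n)"

text \<open>Hilbert's basis theorem: a submodule of the span of all t-powers of A is determined by its
  leading coefficients, which form a monotone family of submodules of A.\<close>

lemma acc_hilbert:
  assumes t: "t \<in> hom G G" and \<Gamma>: "\<Gamma> \<subseteq> hom G G"
    and comm: "\<And>f x. f \<in> \<Gamma> \<Longrightarrow> x \<in> carrier G \<Longrightarrow> f (t x) = t (f x)"
    and A: "A \<in> inv_subgroups G \<Gamma> (carrier G)" and accA: "acc (inv_subgroups G \<Gamma> A)"
  defines "U \<equiv> \<Union>n. power_span t A n"
  shows "U \<in> inv_subgroups G (insert t \<Gamma>) (carrier G)" "A \<subseteq> U"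
    "acc (inv_subgroups G (insert t \<Gamma>) U)"
proof -
  let ?E = "power_span t A"
  interpret T: group_hom G G t by unfold_locales (rule t)
  have sA: "subgroup A G" using A by (simp add: inv_subgroups_def)
  interpret A: subgroup A G by (rule sA)
  have tn: "t ^^ n \<in> hom G G" for n
  proof (induction n)
    case (Suc n)
    then show ?case using hom_compose[OF Suc t] by (auto simp: hom_def Pi_iff)
  qed (auto simp: hom_def)
  have tn_closed: "(t ^^ n) x \<in> carrier G" if "x \<in> carrier G" for n x
    using hom_in_carrier[OF tn that] .
  have commn: "f ((t ^^ n) x) = (t ^^ n) (f x)" if "f \<in> \<Gamma>" "x \<in> carrier G" for f n x
    using that by (induction n) (auto simp: comm tn_closed)
  have one: "{\<one>} \<in> inv_subgroups G \<Gamma> (carrier G)"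
    using \<Gamma> hom_one[OF _ group_axioms group_axioms] by (auto simp: inv_subgroups_def triv_subgroup)
  have E: "?E n \<in> inv_subgroups G \<Gamma> (carrier G)" for n
    by (induction n) (simp_all add: one shifted_sum_inv_subgroups[OF tn \<Gamma> commn A])
  have sE: "subgroup (?E n) G" and E_carr: "?E n \<subseteq> carrier G" for n
    using E[of n] by (auto simp: inv_subgroups_def)
  have E_Suc: "?E n \<subseteq> ?E (Suc n)" for n
  proof
    fix x assume x: "x \<in> ?E n"
    then have "x = (t ^^ n) \<one> \<otimes> x"
      using E_carr[of n] hom_one[OF tn group_axioms group_axioms] by auto
    then show "x \<in> ?E (Suc n)"
      unfolding power_span.simps shifted_sum_def using x A.one_closed by blast
  qed
  have E_mono: "m \<le> n \<Longrightarrow> ?E m \<subseteq> ?E n" for m n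
    using E_Suc by (rule lift_Suc_mono_le)
  have tE: "t x \<in> ?E (Suc n)" if "x \<in> ?E n" for x n
    using that
  proof (induction n arbitrary: x)
    case 0
    then show ?case using subgroup.one_closed[OF sE[of "Suc 0"]] by (simp del: power_span.simps(2))
  next
    case (Suc n)
    then obtain a r where x: "x = (t ^^ n) a \<otimes> r" "a \<in> A" "r \<in> ?E n" by (auto simp: shifted_sum_def)
    then have "t x = (t ^^ Suc n) a \<otimes> t r"
      using E_carr[of n] tn_closed by auto
    with Suc.IH[OF x(3)] x(2) show ?case
      unfolding power_span.simps(2)[of t A "Suc n"] shifted_sum_def by blast
  qed
  have "subgroup U G"
  proof (rule subgroupI)
    show "U \<subseteq> carrier G" using E_carr by (auto simp: U_def)
    show "U \<noteq> {}" using subgroup.one_closed[OF sE] by (auto simp: U_def)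
    show "inv x \<in> U" if "x \<in> U" for x
      using that subgroup.m_inv_closed[OF sE] by (auto simp: U_def)
    fix x y assume "x \<in> U" "y \<in> U"
    then obtain m n where "x \<in> ?E m" "y \<in> ?E n" by (auto simp: U_def)
    then have "x \<in> ?E (max m n)" "y \<in> ?E (max m n)"
      using E_mono[of m "max m n"] E_mono[of n "max m n"] by auto
    then show "x \<otimes> y \<in> U"
      using subgroup.m_closed[OF sE] by (auto simp: U_def)
  qed
  moreover have "f x \<in> U" if f: "f \<in> insert t \<Gamma>" and "x \<in> U" for f x
  proof -
    obtain n where n: "x \<in> ?E n" using \<open>x \<in> U\<close> by (auto simp: U_def)
    from f consider "f = t" | "f \<in> \<Gamma>" by blast
    then have "f x \<in> ?E n \<or> f x \<in> ?E (Suc n)"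
      using tE[OF n] inv_subgroups_image[OF E _ n] by cases blast+
    then show ?thesis unfolding U_def by blast
  qed
  ultimately show U: "U \<in> inv_subgroups G (insert t \<Gamma>) (carrier G)"
    by (auto simp: inv_subgroups_def dest: subgroup.subset)
  have "a \<in> ?E (Suc 0)" if "a \<in> A" for a
    using that A.mem_carrier[OF that] by (auto simp: shifted_sum_def intro!: exI[of _ a])
  then show "A \<subseteq> U" unfolding U_def by blast
  show "acc (inv_subgroups G (insert t \<Gamma>) U)"
    unfolding acc_def
  proof (intro allI impI, elim conjE)
    fix f :: "nat \<Rightarrow> 'a set"
    assume f: "\<forall>i. f i \<in> inv_subgroups G (insert t \<Gamma>) U" and mono: "\<forall>i. f i \<subseteq> f (Suc i)"
    have f\<Gamma>: "f i \<in> inv_subgroups G \<Gamma> (carrier G)" for i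
      using spec[OF f, of i] U unfolding inv_subgroups_def by blast
    have ft: "t x \<in> f i" if "x \<in> f i" for x i
      using inv_subgroups_image[OF spec[OF f, of i] _ that] by blast
    have mono': "i \<le> j \<Longrightarrow> f i \<subseteq> f j" for i j
      using mono by (simp add: lift_Suc_mono_le)
    \<comment> \<open>Leading coefficients in degree n of the i-th member. They grow with i because
      the chain does, and with n because applying \<open>t\<close> raises the degree.\<close>
    define L where "L i n = lead (t ^^ n) A (?E n) (f i)" for i n
    have L: "L i n \<in> inv_subgroups G \<Gamma> A" for i n
      unfolding L_def by (rule lead_inv_subgroups[OF tn \<Gamma> commn A E f\<Gamma>])
    have L1: "L i n \<subseteq> L j n" if "i \<le> j" for i j n
      unfolding L_def by (rule lead_mono[OF mono'[OF that]])
    have "L i n \<subseteq> L i (Suc n)" for i n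
    proof
      fix a assume "a \<in> L i n"
      then obtain r where r: "a \<in> A" "r \<in> ?E n" "(t ^^ n) a \<otimes> r \<in> f i" by (auto simp: L_def lead_def)
      then have "t ((t ^^ n) a \<otimes> r) \<in> f i" using ft by blast
      also have "t ((t ^^ n) a \<otimes> r) = (t ^^ Suc n) a \<otimes> t r"
        using r E_carr[of n] tn_closed by auto
      finally show "a \<in> L i (Suc n)"
        unfolding L_def lead_def using tE[OF r(2)] r(1) by blast
    qed
    then have L2: "m \<le> n \<Longrightarrow> L i m \<subseteq> L i n" for i m n
      by (rule lift_Suc_mono_le)
    have L12: "L i m \<subseteq> L j n" if "i \<le> j" "m \<le> n" for i j m n
      using L1[OF that(1), of m] L2[OF that(2), of j] by blast
    \<comment> \<open>The diagonal handles all degrees from s on at once; the finitely many degrees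
      below s are stabilized one at a time.\<close>
    have "\<exists>s. \<forall>n\<ge>s. L n n = L s s"
      by (rule accD[OF accA]) (simp_all add: L L12)
    then obtain s where s: "\<forall>n\<ge>s. L n n = L s s" ..
    have "\<exists>k. \<forall>i\<ge>k. L i n = L k n" for n
      by (rule accD[OF accA]) (simp_all add: L L12)
    then obtain k where k: "\<forall>i\<ge>k n. L i n = L (k n) n" for n
      by metis
    define N where "N = Max (insert s (k ` {..<s}))"
    have Ns: "s \<le> N" and Nk: "n < s \<Longrightarrow> k n \<le> N" for n
      unfolding N_def by (auto intro!: Max_ge)
    have LN: "L i n \<subseteq> L N n" if i: "i \<ge> N" for i n
    proof (cases "n < s")
      case True
      then show ?thesis using k[rule_format, of n i] k[rule_format, of n N] Nk[OF True] i by simp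
    next
      case False
      have "L i n \<subseteq> L (max i n) (max i n)" by (rule L12) auto
      also have "\<dots> = L s s" using s Ns i by (meson le_trans max.cobounded1)
      also have "\<dots> \<subseteq> L N n" using False Ns by (intro L12) auto
      finally show ?thesis .
    qed
    \<comment> \<open>Induction on the degree bound: agreement below degree n and equal leading
      coefficients in degree n give agreement up to degree n.\<close>
    have "f i \<inter> ?E n \<subseteq> f N" if i: "i \<ge> N" for i n
    proof (induction n)
      case 0
      then show ?case using f\<Gamma>[of N] by (auto simp: inv_subgroups_def subgroup.one_closed)
    next
      case (Suc n)
      show ?case unfolding power_span.simps(2)
      proof (rule lead_determines[OF tn A.subset sE])
        show "subgroup (f N) G" "subgroup (f i) G" using f\<Gamma> by (auto simp: inv_subgroups_def)
        show "f N \<subseteq> f i" by (rule mono'[OF i])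
        show "f i \<inter> ?E n \<subseteq> f N" by (rule Suc)
        show "lead (t ^^ n) A (?E n) (f i) \<subseteq> lead (t ^^ n) A (?E n) (f N)"
          using LN[OF i] by (simp only: L_def)
      qed
    qed
    moreover have "f i \<subseteq> (\<Union>n. ?E n)" for i
      using spec[OF f, of i] by (auto simp: inv_subgroups_def U_def)
    ultimately have "f i \<subseteq> f N" if "i \<ge> N" for i
      using that by blast
    then have "\<forall>i\<ge>N. f i = f N" using mono'[of N] by (simp add: subset_antisym)
    then show "\<exists>n. \<forall>m\<ge>n. f m = f n" ..
  qed
qed

text \<open>The operators are adjoined one at a time by the basis theorem, starting from the cyclic
  group of c. Commutativity makes the leading coefficients with respect to the new operator
  invariant under the earlier ones.\<close>

lemma ex_acc_cyclic_module:
  assumes "finite \<Gamma>" "\<Gamma> \<subseteq> hom G G" "c \<in> carrier G"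
    and "\<And>f g x. f \<in> \<Gamma> \<Longrightarrow> g \<in> \<Gamma> \<Longrightarrow> x \<in> carrier G \<Longrightarrow> f (g x) = g (f x)"
  shows "\<exists>A \<in> inv_subgroups G \<Gamma> (carrier G). c \<in> A \<and> acc (inv_subgroups G \<Gamma> A)"
  using assms
proof (induction \<Gamma>)
  case empty
  have "generate G {c} \<in> inv_subgroups G {} (carrier G)"
    using empty generate_is_subgroup[of "{c}"] generate_incl[of "{c}"] by (simp add: inv_subgroups_def)
  moreover have "c \<in> generate G {c}" by (simp add: generate.incl)
  ultimately show ?case using acc_cyclic[OF \<open>c \<in> carrier G\<close>] by blast
next
  case (insert t \<Gamma>)
  then have "\<exists>A \<in> inv_subgroups G \<Gamma> (carrier G). c \<in> A \<and> acc (inv_subgroups G \<Gamma> A)"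
    by simp
  then obtain A where A: "A \<in> inv_subgroups G \<Gamma> (carrier G)" "c \<in> A" "acc (inv_subgroups G \<Gamma> A)"
    by blast
  have t: "t \<in> hom G G" and \<Gamma>: "\<Gamma> \<subseteq> hom G G" using insert.prems by auto
  have comm: "f (t x) = t (f x)" if "f \<in> \<Gamma>" "x \<in> carrier G" for f x
    using insert.prems that by simp
  note * = acc_hilbert[OF t \<Gamma> comm A(1,3)]
  show ?case by (rule bexI[OF _ *(1)]) (use *(2,3) A(2) in auto)
qed

text \<open>A finite sum of Noetherian modules, one for each element of C.\<close>

lemma ex_acc_module:
  assumes "finite C" and C: "C \<subseteq> carrier G" and \<Gamma>: "finite \<Gamma>" "\<Gamma> \<subseteq> hom G G"
    and comm: "\<And>f g x. f \<in> \<Gamma> \<Longrightarrow> g \<in> \<Gamma> \<Longrightarrow> x \<in> carrier G \<Longrightarrow> f (g x) = g (f x)"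
  shows "\<exists>A \<in> inv_subgroups G \<Gamma> (carrier G). C \<subseteq> A \<and> acc (inv_subgroups G \<Gamma> A)"
  using assms(1) C
proof (induction C)
  case empty
  then show ?case using ex_acc_cyclic_module[OF \<Gamma> one_closed] comm by (simp add: Bex_def) blast
next
  case (insert c C)
  then obtain A where A: "A \<in> inv_subgroups G \<Gamma> (carrier G)" "C \<subseteq> A" "acc (inv_subgroups G \<Gamma> A)"
    by auto
  obtain B where B: "B \<in> inv_subgroups G \<Gamma> (carrier G)" "c \<in> B" "acc (inv_subgroups G \<Gamma> B)"
    using ex_acc_cyclic_module[OF \<Gamma>, of c] comm insert.prems by auto
  have id: "(\<lambda>x. x) \<in> hom G G" by (simp add: hom_def)
  let ?U = "shifted_sum (\<lambda>x. x) A B"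
  have sub: "subgroup A G" "subgroup B G" using A B by (auto simp: inv_subgroups_def)
  have "x \<in> ?U" if "x \<in> A" for x
    unfolding shifted_sum_def using that subgroup.one_closed[OF sub(2)] subgroup.mem_carrier[OF sub(1) that]
    by force
  moreover have "x \<in> ?U" if "x \<in> B" for x
    unfolding shifted_sum_def using that subgroup.one_closed[OF sub(1)] subgroup.mem_carrier[OF sub(2) that]
    by force
  ultimately have "insert c C \<subseteq> ?U" using A B by blast
  moreover have "?U \<in> inv_subgroups G \<Gamma> (carrier G)"
    by (rule shifted_sum_inv_subgroups[OF id \<Gamma>(2) refl A(1) B(1)])
  moreover have "acc (inv_subgroups G \<Gamma> ?U)"
    by (rule acc_shifted_sum[OF id \<Gamma>(2) refl A(1) B(1) A(3) B(3)])
  ultimately show ?case by blast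
qed

end

section \<open>Redundant powers in finitely generated abelian groups\<close>

lemma bezout_sum:
  fixes x :: "nat \<Rightarrow> int"
  shows "\<exists>u. \<forall>j<N. (\<Sum>i<N. u i * x i) dvd x j"
proof (induction N)
  case (Suc N)
  then obtain u where u: "\<forall>j<N. (\<Sum>i<N. u i * x i) dvd x j" by blast
  obtain a b where ab: "a * (\<Sum>i<N. u i * x i) + b * x N = gcd (\<Sum>i<N. u i * x i) (x N)"
    using bezout_int by blast
  define u' where "u' = (\<lambda>i. if i = N then b else a * u i)"
  have "(\<Sum>i<N. u' i * x i) = (\<Sum>i<N. a * (u i * x i))"
    by (intro sum.cong) (auto simp: u'_def)
  then have "(\<Sum>i<Suc N. u' i * x i) = gcd (\<Sum>i<N. u i * x i) (x N)"
    using ab by (simp add: u'_def sum_distrib_left)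
  note eq = this
  have dv: "gcd (\<Sum>i<N. u i * x i) (x N) dvd x j" if "j < Suc N" for j
  proof (cases "j = N")
    case False
    then have "(\<Sum>i<N. u i * x i) dvd x j" using u that by simp
    then show ?thesis by (rule dvd_trans[OF gcd_dvd1])
  qed simp
  show ?case
  proof (intro exI allI impI)
    fix j assume "j < Suc N"
    then show "(\<Sum>i<Suc N. u' i * x i) dvd x j" unfolding eq by (rule dv)
  qed
qed simp

text \<open>Two of the D + 1 prefix sums agree modulo D; expressing their difference through the
  gcd g = sum u x of the numbers gives a relation in which one coefficient is 1 modulo D.
  Multiplying by that coefficient makes it positive.\<close>

lemma int_relation_one:
  fixes x :: "nat \<Rightarrow> int" and D :: nat
  assumes D: "D \<ge> 2"
  shows "\<exists>k<Suc D. \<exists>c. (\<exists>j :: nat. c k = 1 + int D * int j) \<and> (\<Sum>i<Suc D. c i * x i) = 0"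
proof -
  obtain u where "\<forall>j<Suc D. (\<Sum>i<Suc D. u i * x i) dvd x j" using bezout_sum by blast
  then obtain y where y: "\<And>j. j < Suc D \<Longrightarrow> x j = (\<Sum>i<Suc D. u i * x i) * y j"
    unfolding dvd_def by metis
  define g where "g = (\<Sum>i<Suc D. u i * x i)"
  note y = y[folded g_def]
  define Y where "Y i = (\<Sum>l<i. y l)" for i
  have "\<not> inj_on (\<lambda>i. Y i mod int D) {..D}"
  proof
    assume "inj_on (\<lambda>i. Y i mod int D) {..D}"
    then have "card {..D} \<le> card {0..<int D}"
      using D by (intro card_inj_on_le) auto
    then show False by simp
  qed
  then obtain i i' where i: "i < i'" "i' \<le> D" "Y i' mod int D = Y i mod int D"
    unfolding inj_on_def by (metis atMost_iff linorder_neqE_nat)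
  then obtain t where t: "Y i' - Y i = int D * t"
    by (metis dvd_def mod_eq_dvd_iff)
  have Ydiff: "Y i' - Y i = (\<Sum>l\<in>{i..<i'}. y l)"
    using i sum_diff_nat_ivl[of 0 i i' y] by (simp add: Y_def lessThan_atLeast0)
  \<comment> \<open>Subtracting D * t times the Bezout coefficients removes the contribution g * D *
    t of the interval without changing residues modulo D. At the left end \<open>i\<close> the
    residue is 1.\<close>
  define c where "c l = (if l \<in> {i..<i'} then 1 else 0) - int D * t * u l" for l
  have "(\<Sum>l<Suc D. c l * x l)
      = (\<Sum>l<Suc D. (if l \<in> {i..<i'} then x l else 0)) - int D * t * g"
    by (simp only: c_def g_def left_diff_distrib sum_subtractf sum_distrib_left mult.assoc)
      (auto intro!: sum.cong)
  also have "(\<Sum>l<Suc D. (if l \<in> {i..<i'} then x l else 0)) = (\<Sum>l\<in>{i..<i'}. x l)"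
    using i by (intro sum.mono_neutral_cong_right) auto
  also have "\<dots> = (\<Sum>l\<in>{i..<i'}. g * y l)"
    using i by (intro sum.cong[OF refl] y) auto
  also have "\<dots> = g * (int D * t)"
    using Ydiff t by (simp add: sum_distrib_left)
  finally have zero: "(\<Sum>l<Suc D. c l * x l) = 0" by simp
  define w where "w = t * u i"
  have ci: "c i = 1 - int D * w" using i by (simp add: c_def w_def)
  \<comment> \<open>The square of \<open>c i\<close> is 1 + D * w * (D * w - 2), and D at least 2
    keeps w * (D * w - 2) nonnegative for every integer w. For D = 1 and w = 1 the square would be
    0.\<close>
  have "w * (int D * w - 2) \<ge> 0"
  proof (cases "w \<ge> 1")
    case True
    then have "int D * w \<ge> 2 * 1" using D by (intro mult_mono) auto
    then show ?thesis using True by simp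
  next
    case False
    then have "int D * w \<le> 0" using D by (simp add: mult_nonneg_nonpos)
    then show ?thesis using False by (intro mult_nonpos_nonpos) auto
  qed
  moreover have "c i * c i = 1 + int D * (w * (int D * w - 2))"
    unfolding ci by (simp add: algebra_simps)
  ultimately have "c i * c i = 1 + int D * int (nat (w * (int D * w - 2)))" by simp
  then have "\<exists>j :: nat. c i * c i = 1 + int D * int j" ..
  moreover have "(\<Sum>l<Suc D. c i * c l * x l) = 0"
    using zero by (simp only: mult.assoc sum_distrib_left[symmetric] mult_zero_right)
  ultimately have "\<exists>d. (\<exists>j :: nat. d i = 1 + int D * int j) \<and> (\<Sum>l<Suc D. d l * x l) = 0"
    by (intro exI[of _ "\<lambda>l. c i * c l"] conjI)
  moreover have "i < Suc D" using i by simp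
  ultimately show ?thesis by (intro exI[of _ i] conjI)
qed

lemma block_index:
  fixes l :: nat
  assumes "l < M"
  shows "(q * M + l) div M = q" "(q * M + l) mod M = l"
  using assms by simp_all

text \<open>Induction on the number of coordinates, with N * (D + 1) vectors cut into N blocks. A
  relation inside each block clears the new coordinate, the induction hypothesis relates the N
  resulting combinations, and the two distinguished coefficients multiply to one that is again 1
  modulo D. So N = (D + 1)^r suffices.\<close>

lemma int_relation:
  fixes D :: nat
  assumes D: "D \<ge> 2"
  shows "\<exists>N\<ge>1. \<forall>x :: nat \<Rightarrow> nat \<Rightarrow> int. \<exists>k<N. \<exists>c. (\<exists>j :: nat. c k = 1 + int D * int j) \<and>
    (\<forall>i<r. (\<Sum>l<N. c l * x l i) = 0)"
proof (induction r)
  case 0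
  show ?case by (intro exI[of _ 1] conjI allI exI[of _ 0] exI[of _ "\<lambda>_. 1"]) auto
next
  case (Suc r)
  then obtain N where N: "N \<ge> 1" "\<And>x :: nat \<Rightarrow> nat \<Rightarrow> int. \<exists>k<N. \<exists>c.
      (\<exists>j :: nat. c k = 1 + int D * int j) \<and> (\<forall>i<r. (\<Sum>l<N. c l * x l i) = 0)"
    by blast
  let ?M = "Suc D"
  have "\<exists>k<N * ?M. \<exists>c. (\<exists>j :: nat. c k = 1 + int D * int j) \<and>
      (\<forall>i<Suc r. (\<Sum>l<N * ?M. c l * x l i) = 0)" for x :: "nat \<Rightarrow> nat \<Rightarrow> int"
  proof -
    define R where "R q k c \<longleftrightarrow> (\<exists>j :: nat. c k = 1 + int D * int j) \<and>
        (\<Sum>l<?M. c l * x (q * ?M + l) r) = 0" for q k c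
    have "\<exists>k<?M. \<exists>c. R q k c" for q
      unfolding R_def by (rule int_relation_one[OF D])
    then obtain \<kappa> c where \<kappa>: "\<And>q. \<kappa> q < ?M" and R: "\<And>q. R q (\<kappa> q) (c q)"
      by metis
    have zero: "(\<Sum>l<?M. c q l * x (q * ?M + l) r) = 0" for q
      using R[of q] by (simp only: R_def)
    have c: "\<exists>j :: nat. c q (\<kappa> q) = 1 + int D * int j" for q
      using R[of q] by (simp only: R_def)
    define y where "y q i = (\<Sum>l<?M. c q l * x (q * ?M + l) i)" for q i
    obtain k e j' where k: "k < N" and e: "e k = 1 + int D * int j'"
      and e0: "\<And>i. i < r \<Longrightarrow> (\<Sum>q<N. e q * y q i) = 0"
      using N(2)[of y] by blast
    define d where "d m = e (m div ?M) * c (m div ?M) (m mod ?M)" for m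
    have "(\<Sum>m<N * ?M. d m * x m i) = (\<Sum>q<N. e q * y q i)" for i
    proof -
      have "(\<Sum>m<N * ?M. d m * x m i) = (\<Sum>q<N. \<Sum>m=q*?M..<q*?M+?M. d m * x m i)"
        by (rule sum.nat_group[symmetric])
      also have "\<dots> = (\<Sum>q<N. e q * y q i)"
      proof (rule sum.cong[OF refl])
        fix q
        have "(\<Sum>m=q*?M..<q*?M+?M. d m * x m i) = (\<Sum>l<?M. d (q * ?M + l) * x (q * ?M + l) i)"
          by (simp only: sum.atLeastLessThan_shift_0[of _ "q * ?M"] lessThan_atLeast0
              diff_add_inverse comp_def)
        also have "\<dots> = (\<Sum>l<?M. e q * (c q l * x (q * ?M + l) i))"
        proof (rule sum.cong[OF refl])
          fix l assume "l \<in> {..<?M}"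
          then have "l < ?M" by simp
          from block_index[OF this] show "d (q * ?M + l) * x (q * ?M + l) i = e q * (c q l * x (q * ?M + l) i)"
            by (simp only: d_def mult.assoc)
        qed
        finally show "(\<Sum>m=q*?M..<q*?M+?M. d m * x m i) = e q * y q i"
          by (simp only: y_def sum_distrib_left)
      qed
      finally show ?thesis .
    qed
    then have "\<forall>i<Suc r. (\<Sum>m<N * ?M. d m * x m i) = 0"
      using e0 zero by (simp add: less_Suc_eq y_def)
    moreover have "k * ?M + \<kappa> k < N * ?M"
    proof -
      have "k * ?M + \<kappa> k < k * ?M + ?M" using \<kappa> by (rule add_strict_left_mono)
      also have "\<dots> = Suc k * ?M" by simp
      also have "\<dots> \<le> N * ?M" using k by (intro mult_le_mono1) simp
      finally show ?thesis .
    qed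
    moreover obtain j where "c k (\<kappa> k) = 1 + int D * int j" using c by blast
    then have "d (k * ?M + \<kappa> k) = 1 + int D * int (j' + j + D * j' * j)"
      unfolding d_def block_index[OF \<kappa>] e by (simp add: algebra_simps)
    then have "\<exists>j. d (k * ?M + \<kappa> k) = 1 + int D * int j" ..
    ultimately have "k * ?M + \<kappa> k < N * ?M \<and> (\<exists>c. (\<exists>j. c (k * ?M + \<kappa> k) = 1 + int D * int j) \<and>
        (\<forall>i<Suc r. (\<Sum>l<N * ?M. c l * x l i) = 0))"
      by (intro conjI exI[of _ d])
    then show ?thesis ..
  qed
  note relation = this
  show ?case
  proof (rule exI[of _ "N * ?M"], intro conjI allI)
    show "1 \<le> N * ?M" using N(1) by simp
  qed (rule relation)
qed

section \<open>Transfer from integer vectors to finitely generated abelian groups\<close>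

context comm_group
begin

lemma subgroup_finprod_closed:
  assumes H: "subgroup H G" and "finite A" and f: "\<And>i. i \<in> A \<Longrightarrow> f i \<in> H"
  shows "finprod G f A \<in> H"
  using assms(2) f
proof (induction A)
  case empty
  then show ?case by (simp add: subgroup.one_closed[OF H])
next
  case (insert i A)
  then have "f \<in> A \<rightarrow> carrier G" "f i \<in> carrier G"
    using subgroup.mem_carrier[OF H] by auto
  with insert show ?case by (simp add: subgroup.m_closed[OF H])
qed

lemma generate_finite_range:
  assumes g: "g \<in> {..<r} \<rightarrow> carrier G" and x: "x \<in> generate G (g ` {..<r})"
  shows "\<exists>e :: nat \<Rightarrow> int. x = finprod G (\<lambda>i. g i [^] e i) {..<r}"
proof -
  define \<phi> where "\<phi> e = finprod G (\<lambda>i. g i [^] e i) {..<r}" for e :: "nat \<Rightarrow> int"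
  have gi: "g i \<in> carrier G" if "i < r" for i using g that by auto
  have mult: "\<phi> e \<otimes> \<phi> e' = \<phi> (\<lambda>i. e i + e' i)" for e e'
  proof -
    have "\<phi> (\<lambda>i. e i + e' i) = finprod G (\<lambda>i. g i [^] e i \<otimes> g i [^] e' i) {..<r}"
      unfolding \<phi>_def using gi by (intro finprod_cong') (auto simp: int_pow_mult)
    also have "\<dots> = \<phi> e \<otimes> \<phi> e'"
      unfolding \<phi>_def using gi by (intro finprod_multf) auto
    finally show ?thesis ..
  qed
  have one: "\<phi> (\<lambda>_. 0) = \<one>" by (simp add: \<phi>_def)
  have gen: "\<phi> (\<lambda>l. if l = i then z else 0) = g i [^] z" if "i < r" for i z
  proof -
    have "\<phi> (\<lambda>l. if l = i then z else 0) = finprod G (\<lambda>l. if i = l then g l [^] z else \<one>) {..<r}"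
      unfolding \<phi>_def using gi by (intro finprod_cong') auto
    also have "\<dots> = g i [^] z"
      using that gi by (intro finprod_singleton) auto
    finally show ?thesis .
  qed
  from x show ?thesis unfolding \<phi>_def[symmetric]
  proof (induction rule: generate.induct)
    case one
    then show ?case using \<open>\<phi> (\<lambda>_. 0) = \<one>\<close> by metis
  next
    case (incl h)
    then obtain i where i: "i < r" "h = g i" by auto
    then show ?case using gen[OF i(1), of 1] gi by (metis int_pow_1)
  next
    case (inv h)
    then obtain i where i: "i < r" "h = g i" by auto
    then show ?case using gen[OF i(1), of "-1"] gi by (metis int_pow_1 int_pow_neg)
  next
    case (eng h1 h2)
    then show ?case using mult by metis
  qed
qed

text \<open>The exponent vectors of the elements live in Z^r, so \<open>int_relation\<close> applies
  whatever relations hold between the generators of G. The distinguished coefficient 1 + D * j is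
  positive, hence a natural exponent, and the relation is solved for that power.\<close>

lemma redundant_power:
  assumes S: "finite S" "S \<subseteq> carrier G" "generate G S = carrier G" and D: "(D :: nat) \<ge> 2"
  shows "\<exists>N :: nat. N \<ge> 1 \<and> (\<forall>v. (\<forall>l<N. v l \<in> carrier G) \<longrightarrow>
    (\<exists>k<N. \<exists>j :: nat. v k [^] (1 + D * j) \<in> generate G (v ` ({..<N} - {k}))))"
proof -
  obtain g and r :: nat where Sg: "S = g ` {..<r}"
    using finite_imp_nat_seg_image_inj_on[OF S(1)] by (metis lessThan_def)
  have g: "g \<in> {..<r} \<rightarrow> carrier G" using S(2) Sg by auto
  obtain N where N: "N \<ge> 1" "\<And>x :: nat \<Rightarrow> nat \<Rightarrow> int. \<exists>k<N. \<exists>c.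
      (\<exists>j :: nat. c k = 1 + int D * int j) \<and> (\<forall>i<r. (\<Sum>l<N. c l * x l i) = 0)"
    using int_relation[OF D, of r] by blast
  have "\<exists>k<N. \<exists>j :: nat. v k [^] (1 + D * j) \<in> generate G (v ` ({..<N} - {k}))"
    if v: "\<forall>l<N. v l \<in> carrier G" for v
  proof -
    have "\<exists>e :: nat \<Rightarrow> int. v l = finprod G (\<lambda>i. g i [^] e i) {..<r}" if "l < N" for l
      using generate_finite_range[OF g, of "v l"] v that S(3) Sg by auto
    then obtain x :: "nat \<Rightarrow> nat \<Rightarrow> int"
      where x: "\<And>l. l < N \<Longrightarrow> v l = finprod G (\<lambda>i. g i [^] x l i) {..<r}"
      by metis
    obtain k c j where k: "k < N" and ck: "c k = 1 + int D * int j"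
      and zero: "\<And>i. i < r \<Longrightarrow> (\<Sum>l<N. c l * x l i) = 0"
      using N(2)[of x] by blast
    have gi: "g i \<in> carrier G" if "i < r" for i using g that by auto
    have "finprod G (\<lambda>l. v l [^] c l) {..<n} = finprod G (\<lambda>i. g i [^] (\<Sum>l<n. c l * x l i)) {..<r}"
      if "n \<le> N" for n
      using that
    proof (induction n)
      case 0
      then show ?case by simp
    next
      case (Suc n)
      have pow: "finprod G (\<lambda>i. g i [^] e i) A [^] z = finprod G (\<lambda>i. g i [^] (e i * z)) A"
        if "finite A" "A \<subseteq> {..<r}" for e :: "nat \<Rightarrow> int" and z :: int and A
        using that
      proof (induction A)
        case (insert a A)
        have "(\<lambda>i. g i [^] e' i) \<in> A \<rightarrow> carrier G" for e' :: "nat \<Rightarrow> int"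
          using insert.prems gi by auto
        with insert gi show ?case by (simp add: int_pow_distrib int_pow_pow)
      qed simp
      have vn: "v n \<in> carrier G" "(\<lambda>l. v l [^] c l) \<in> {..<n} \<rightarrow> carrier G"
        using v Suc.prems by auto
      have "finprod G (\<lambda>l. v l [^] c l) {..<Suc n} = v n [^] c n \<otimes> finprod G (\<lambda>l. v l [^] c l) {..<n}"
        using vn by (simp add: lessThan_Suc)
      also have "\<dots> = finprod G (\<lambda>i. g i [^] (x n i * c n)) {..<r} \<otimes>
          finprod G (\<lambda>i. g i [^] (\<Sum>l<n. c l * x l i)) {..<r}"
        using Suc x[of n] pow[of "{..<r}"] by simp
      also have "\<dots> = finprod G (\<lambda>i. g i [^] (\<Sum>l<Suc n. c l * x l i)) {..<r}"
      proof -
        have "finprod G (\<lambda>i. g i [^] (\<Sum>l<Suc n. c l * x l i)) {..<r} =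
            finprod G (\<lambda>i. g i [^] (x n i * c n) \<otimes> g i [^] (\<Sum>l<n. c l * x l i)) {..<r}"
          using gi by (intro finprod_cong') (auto simp: int_pow_mult[symmetric] mult.commute add.commute)
        also have "\<dots> = finprod G (\<lambda>i. g i [^] (x n i * c n)) {..<r} \<otimes>
            finprod G (\<lambda>i. g i [^] (\<Sum>l<n. c l * x l i)) {..<r}"
          using gi by (intro finprod_multf) auto
        finally show ?thesis ..
      qed
      finally show ?case .
    qed
    from this[of N] have "finprod G (\<lambda>l. v l [^] c l) {..<N} =
        finprod G (\<lambda>i. g i [^] (\<Sum>l<N. c l * x l i)) {..<r}" by simp
    also have "\<dots> = finprod G (\<lambda>i. \<one>) {..<r}"
      by (rule finprod_cong') (simp_all add: zero)
    also have "\<dots> = \<one>" by simp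
    finally have "finprod G (\<lambda>l. v l [^] c l) {..<N} = \<one>" .
    then have "finprod G (\<lambda>l. v l [^] c l) (insert k ({..<N} - {k})) = \<one>"
      using k by (simp add: insert_absorb)
    moreover have V: "(\<lambda>l. v l [^] c l) \<in> {..<N} - {k} \<rightarrow> carrier G" "v k [^] c k \<in> carrier G"
      using v k by auto
    ultimately have one: "v k [^] c k \<otimes> finprod G (\<lambda>l. v l [^] c l) ({..<N} - {k}) = \<one>"
      by (subst (asm) finprod_insert) auto
    have sub: "v ` ({..<N} - {k}) \<subseteq> carrier G" using v by auto
    note H = generate_is_subgroup[OF sub]
    have fin: "finprod G (\<lambda>l. v l [^] c l) ({..<N} - {k}) \<in> generate G (v ` ({..<N} - {k}))"
      by (rule subgroup_finprod_closed[OF H], simp,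
          rule subgroup_int_pow_closed[OF H], rule generate.incl, simp)
    have "v k [^] c k = inv (finprod G (\<lambda>l. v l [^] c l) ({..<N} - {k}))"
      using inv_equality[OF one] V by (metis finprod_closed inv_equality)
    then have "v k [^] c k \<in> generate G (v ` ({..<N} - {k}))"
      using subgroup.m_inv_closed[OF H fin] by simp
    moreover have "c k = int (1 + D * j)" using ck by simp
    ultimately have "v k [^] (1 + D * j) \<in> generate G (v ` ({..<N} - {k}))"
      by (simp only: int_pow_int)
    with k show ?thesis by blast
  qed
  note redundant = this
  show ?thesis
  proof (rule exI[of _ N], rule conjI[OF N(1)], intro allI impI)
  qed (rule redundant)
qed

end

section \<open>Rigidity of Noetherian modules\<close>

text \<open>In the application \<open>Q\<close> is the whole group G acting by conjugation on G'.
  There the operators commute although elements of \<open>Q\<close> need not, so the finiteness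
  condition on \<open>Q\<close> is later imposed only on subgroups containing the kernel of the
  action.\<close>

locale op_module = comm_group M + Q: group Q for M (structure) and Q (structure) +
  fixes act :: "'c \<Rightarrow> 'a \<Rightarrow> 'a"
  assumes act_hom: "q \<in> carrier Q \<Longrightarrow> act q \<in> hom M M"
    and act_mult: "q \<in> carrier Q \<Longrightarrow> r \<in> carrier Q \<Longrightarrow> x \<in> carrier M \<Longrightarrow>
      act (q \<otimes>\<^bsub>Q\<^esub> r) x = act q (act r x)"
    and act_one: "x \<in> carrier M \<Longrightarrow> act \<one>\<^bsub>Q\<^esub> x = x"
    and act_commute: "q \<in> carrier Q \<Longrightarrow> r \<in> carrier Q \<Longrightarrow> x \<in> carrier M \<Longrightarrow>
      act q (act r x) = act r (act q x)"
begin

abbreviation submodules :: "'a set set" where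
  "submodules \<equiv> inv_subgroups M (act ` carrier Q) (carrier M)"

abbreviation act_kernel :: "'c set" where
  "act_kernel \<equiv> {q \<in> carrier Q. \<forall>x\<in>carrier M. act q x = x}"

text \<open>Stands in for equality in the quotient module M/K, which is not formed.\<close>

definition cong_mod :: "'a set \<Rightarrow> 'a \<Rightarrow> 'a \<Rightarrow> bool" where
  "cong_mod K x y \<longleftrightarrow> x \<in> carrier M \<and> y \<in> carrier M \<and> x \<otimes> inv y \<in> K"

text \<open>The preimage in M of the fixed points of q on M/K.\<close>

definition fixmod :: "'a set \<Rightarrow> 'c \<Rightarrow> 'a set" where
  "fixmod K q = {x \<in> carrier M. cong_mod K (act q x) x}"

text \<open>The elements of Q whose e-th power acts trivially on the image of L in M/K; a subgroup
  because the operators commute.\<close>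

definition power_stabilizer :: "'a set \<Rightarrow> 'a set \<Rightarrow> nat \<Rightarrow> 'c set" where
  "power_stabilizer K L e = {q \<in> carrier Q. L \<subseteq> fixmod K (q [^]\<^bsub>Q\<^esub> e)}"

lemma act_closed [simp]: "q \<in> carrier Q \<Longrightarrow> x \<in> carrier M \<Longrightarrow> act q x \<in> carrier M"
  using act_hom by (auto simp: hom_def)

lemma act_m: "q \<in> carrier Q \<Longrightarrow> x \<in> carrier M \<Longrightarrow> y \<in> carrier M \<Longrightarrow> act q (x \<otimes> y) = act q x \<otimes> act q y"
  using act_hom by (auto simp: hom_def)

lemma act_inv: "q \<in> carrier Q \<Longrightarrow> x \<in> carrier M \<Longrightarrow> act q (inv x) = inv (act q x)"
  by (rule group_hom.hom_inv[of M M]) (unfold_locales, rule act_hom)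

lemma submoduleD:
  assumes "K \<in> submodules"
  shows "subgroup K M" "K \<subseteq> carrier M" "\<And>q x. q \<in> carrier Q \<Longrightarrow> x \<in> K \<Longrightarrow> act q x \<in> K"
  using assms unfolding inv_subgroups_def by blast+

lemma submoduleI:
  assumes "subgroup K M" "\<And>q x. q \<in> carrier Q \<Longrightarrow> x \<in> K \<Longrightarrow> act q x \<in> K"
  shows "K \<in> submodules"
  using assms subgroup.subset[OF assms(1)] unfolding inv_subgroups_def by blast

lemma submodule_Int: "K \<in> submodules \<Longrightarrow> L \<in> submodules \<Longrightarrow> K \<inter> L \<in> submodules"
  by (intro submoduleI subgroups_Inter_pair) (auto dest: submoduleD)

lemma submodule_carrier: "carrier M \<in> submodules"
  by (intro submoduleI subgroup_self act_closed)

lemma cong_mod_trivial: "cong_mod {\<one>} x y \<longleftrightarrow> x \<in> carrier M \<and> x = y"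
proof -
  have "x \<otimes> inv y = \<one> \<longleftrightarrow> x = y" if "x \<in> carrier M" "y \<in> carrier M"
    using that inv_solve_right'[of "\<one>" x y] by auto
  then show ?thesis by (auto simp: cong_mod_def)
qed

section \<open>Congruences and fixed points modulo a submodule\<close>

context
  fixes K assumes K: "K \<in> submodules"
begin

interpretation K: subgroup K M by (rule submoduleD(1)[OF K])

lemma cong_mod_refl: "x \<in> carrier M \<Longrightarrow> cong_mod K x x"
  by (simp add: cong_mod_def)

lemma cong_mod_sym: "cong_mod K x y \<Longrightarrow> cong_mod K y x"
  using K.m_inv_closed[of "x \<otimes> inv y"] by (auto simp: cong_mod_def inv_mult m_comm)

lemma cong_mod_mult:
  assumes "cong_mod K x y" "cong_mod K x' y'"
  shows "cong_mod K (x \<otimes> x') (y \<otimes> y')"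
proof -
  have "(x \<otimes> inv y) \<otimes> (x' \<otimes> inv y') \<in> K" using assms by (auto simp: cong_mod_def)
  also have "(x \<otimes> inv y) \<otimes> (x' \<otimes> inv y') = x \<otimes> x' \<otimes> inv (y \<otimes> y')"
    using assms by (simp add: cong_mod_def inv_mult m_ac)
  finally show ?thesis using assms by (simp add: cong_mod_def)
qed

lemma cong_mod_inv: "cong_mod K x y \<Longrightarrow> cong_mod K (inv x) (inv y)"
  using K.m_inv_closed[of "x \<otimes> inv y"] by (auto simp: cong_mod_def inv_mult)

lemma cong_mod_trans:
  assumes "cong_mod K x y" "cong_mod K y z"
  shows "cong_mod K x z"
proof -
  have "(x \<otimes> inv y) \<otimes> (y \<otimes> inv z) \<in> K" using assms by (auto simp: cong_mod_def)
  also have "(x \<otimes> inv y) \<otimes> (y \<otimes> inv z) = x \<otimes> (inv y \<otimes> y) \<otimes> inv z"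
    using assms by (simp only: cong_mod_def m_assoc inv_closed m_closed)
  finally show ?thesis using assms by (simp add: cong_mod_def)
qed

lemma cong_mod_act:
  assumes "q \<in> carrier Q" "cong_mod K x y"
  shows "cong_mod K (act q x) (act q y)"
proof -
  have "act q (x \<otimes> inv y) \<in> K" using assms submoduleD(3)[OF K] by (simp add: cong_mod_def)
  then show ?thesis using assms by (simp add: cong_mod_def act_m act_inv)
qed

lemma cong_mod_one: "x \<in> carrier M \<Longrightarrow> cong_mod K x \<one> \<longleftrightarrow> x \<in> K"
  by (simp add: cong_mod_def)

lemma cong_mod_cancel: "x \<in> carrier M \<Longrightarrow> y \<in> carrier M \<Longrightarrow> cong_mod K (x \<otimes> y) x \<Longrightarrow> y \<in> K"
  using m_lcomm[of x y "inv x"] by (simp add: cong_mod_def m_assoc)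

text \<open>Invariance rests on commuting operators: applying r to the congruence of q x and x gives
  the congruence of q (r x) and r x.\<close>

lemma fixmod_submodule:
  assumes q: "q \<in> carrier Q"
  shows "fixmod K q \<in> submodules" "K \<subseteq> fixmod K q"
proof -
  show "fixmod K q \<in> submodules"
  proof (rule submoduleI)
    show "subgroup (fixmod K q) M"
    proof (rule subgroupI)
      show "fixmod K q \<subseteq> carrier M" by (auto simp: fixmod_def)
      have "act q \<one> = \<one>"
        by (rule group_hom.hom_one[of M M]) (unfold_locales, rule act_hom[OF q])
      then have "\<one> \<in> fixmod K q" by (simp add: fixmod_def cong_mod_refl)
      then show "fixmod K q \<noteq> {}" by blast
    qed (auto simp: fixmod_def act_m act_inv q intro: cong_mod_mult cong_mod_inv)
    fix r x assume r: "r \<in> carrier Q" and x: "x \<in> fixmod K q"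
    then have "cong_mod K (act r (act q x)) (act r x)" by (auto simp: fixmod_def intro: cong_mod_act)
    then show "act r x \<in> fixmod K q"
      using act_commute[OF q r] x r by (simp add: fixmod_def)
  qed
  show "K \<subseteq> fixmod K q"
  proof
    fix x assume x: "x \<in> K"
    then have "act q x \<in> K" using submoduleD(3)[OF K q] by blast
    with x show "x \<in> fixmod K q" by (simp add: fixmod_def cong_mod_def)
  qed
qed

lemma fixmod_mult:
  assumes "q \<in> carrier Q" "r \<in> carrier Q" "x \<in> fixmod K q" "x \<in> fixmod K r"
  shows "x \<in> fixmod K (q \<otimes>\<^bsub>Q\<^esub> r)"
proof -
  have x: "x \<in> carrier M" "cong_mod K (act q x) x" "cong_mod K (act r x) x" using assms by (auto simp: fixmod_def)
  then have "cong_mod K (act q (act r x)) x"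
    using cong_mod_trans[OF cong_mod_act[OF assms(1) x(3)] x(2)] by simp
  with x(1) show ?thesis using act_mult[OF assms(1,2) x(1)] by (simp add: fixmod_def)
qed

lemma fixmod_inv:
  assumes q: "q \<in> carrier Q" and x: "x \<in> fixmod K q"
  shows "x \<in> fixmod K (inv\<^bsub>Q\<^esub> q)"
proof -
  have x': "x \<in> carrier M" "cong_mod K (act q x) x" using x by (auto simp: fixmod_def)
  have "act (inv\<^bsub>Q\<^esub> q) (act q x) = x"
    using act_mult[of "inv\<^bsub>Q\<^esub> q" q x] q x' by (simp add: act_one)
  then have "cong_mod K x (act (inv\<^bsub>Q\<^esub> q) x)"
    using cong_mod_act[OF _ x'(2), of "inv\<^bsub>Q\<^esub> q"] q by simp
  then show ?thesis using x'(1) cong_mod_sym by (simp add: fixmod_def)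
qed

lemma fixmod_pow:
  assumes q: "q \<in> carrier Q" and x: "x \<in> fixmod K q"
  shows "x \<in> fixmod K (q [^]\<^bsub>Q\<^esub> (n :: nat))"
proof (induction n)
  case 0
  then show ?case using x by (simp add: fixmod_def act_one cong_mod_refl)
next
  case (Suc n)
  then show ?case using fixmod_mult[OF _ q _ x] q by simp
qed

text \<open>In Q itself (q r)^n and q^n r^n may differ; they act alike because the operators
  commute.\<close>

lemma act_pow_mult:
  assumes "q \<in> carrier Q" "r \<in> carrier Q" "x \<in> carrier M"
  shows "act ((q \<otimes>\<^bsub>Q\<^esub> r) [^]\<^bsub>Q\<^esub> (n :: nat)) x = act (q [^]\<^bsub>Q\<^esub> n \<otimes>\<^bsub>Q\<^esub> r [^]\<^bsub>Q\<^esub> n) x"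
  using assms
proof (induction n arbitrary: x)
  case (Suc n)
  have "act (r [^]\<^bsub>Q\<^esub> n) (act q (act r x)) = act q (act (r [^]\<^bsub>Q\<^esub> n) (act r x))"
    using Suc.prems by (intro act_commute) auto
  with Suc show ?case by (simp add: act_mult)
qed simp

lemma fixmod_cong:
  assumes "\<And>x. x \<in> carrier M \<Longrightarrow> act q x = act r x"
  shows "fixmod K q = fixmod K r"
  using assms by (auto simp: fixmod_def)

lemma power_stabilizer_subgroup:
  assumes "L \<subseteq> carrier M"
  shows "subgroup (power_stabilizer K L e) Q" "act_kernel \<subseteq> power_stabilizer K L e"
proof -
  have fm: "fixmod K ((q \<otimes>\<^bsub>Q\<^esub> r) [^]\<^bsub>Q\<^esub> e) = fixmod K (q [^]\<^bsub>Q\<^esub> e \<otimes>\<^bsub>Q\<^esub> r [^]\<^bsub>Q\<^esub> e)"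
    if "q \<in> carrier Q" "r \<in> carrier Q" for q r
    using act_pow_mult[OF that] by (rule fixmod_cong)
  show ker: "act_kernel \<subseteq> power_stabilizer K L e"
  proof
    fix q assume "q \<in> act_kernel"
    then have q: "q \<in> carrier Q" "\<forall>x\<in>carrier M. act q x = x" by auto
    then have "L \<subseteq> fixmod K q" using assms by (auto simp: fixmod_def cong_mod_refl)
    then have "L \<subseteq> fixmod K (q [^]\<^bsub>Q\<^esub> e)" using fixmod_pow[OF q(1)] by blast
    with q show "q \<in> power_stabilizer K L e" by (simp add: power_stabilizer_def)
  qed
  show "subgroup (power_stabilizer K L e) Q"
  proof (rule Q.subgroupI)
    show "power_stabilizer K L e \<subseteq> carrier Q" by (auto simp: power_stabilizer_def)
    have "\<one>\<^bsub>Q\<^esub> \<in> act_kernel" by (simp add: act_one)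
    then show "power_stabilizer K L e \<noteq> {}" using ker by blast
  next
    fix q assume "q \<in> power_stabilizer K L e"
    then have q: "q \<in> carrier Q" "L \<subseteq> fixmod K (q [^]\<^bsub>Q\<^esub> e)" by (auto simp: power_stabilizer_def)
    then have "L \<subseteq> fixmod K (inv\<^bsub>Q\<^esub> (q [^]\<^bsub>Q\<^esub> e))" using fixmod_inv[of "q [^]\<^bsub>Q\<^esub> e"] by auto
    then show "inv\<^bsub>Q\<^esub> q \<in> power_stabilizer K L e"
      using q by (simp add: power_stabilizer_def Q.nat_pow_inv)
  next
    fix q r assume "q \<in> power_stabilizer K L e" "r \<in> power_stabilizer K L e"
    then have q: "q \<in> carrier Q" "L \<subseteq> fixmod K (q [^]\<^bsub>Q\<^esub> e)"
      and r: "r \<in> carrier Q" "L \<subseteq> fixmod K (r [^]\<^bsub>Q\<^esub> e)" by (auto simp: power_stabilizer_def)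
    then have "L \<subseteq> fixmod K (q [^]\<^bsub>Q\<^esub> e \<otimes>\<^bsub>Q\<^esub> r [^]\<^bsub>Q\<^esub> e)"
      using fixmod_mult[of "q [^]\<^bsub>Q\<^esub> e" "r [^]\<^bsub>Q\<^esub> e"] by (auto simp: subset_iff)
    then show "q \<otimes>\<^bsub>Q\<^esub> r \<in> power_stabilizer K L e"
      using q(1) r(1) by (simp add: power_stabilizer_def fm)
  qed
qed

text \<open>Modulo K the operator is unipotent on the span of x and y, each application adding one
  more y to x. A fixed point x of q^n thus produces an element y with n y = 0 in M/K.\<close>

lemma unipotent_step:
  assumes q: "q \<in> carrier Q" and x: "x \<in> carrier M" and y: "y \<in> carrier M"
    and qx: "cong_mod K (act q x) (x \<otimes> y)" and qy: "cong_mod K (act q y) y"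
  shows "cong_mod K (act (q [^]\<^bsub>Q\<^esub> (n :: nat)) x) (x \<otimes> y [^] n)"
proof (induction n)
  case 0
  then show ?case using x by (simp add: act_one cong_mod_refl)
next
  case (Suc n)
  have "act (q [^]\<^bsub>Q\<^esub> Suc n) x = act q (act (q [^]\<^bsub>Q\<^esub> n) x)"
    using q x by (simp add: act_mult act_commute)
  moreover have "cong_mod K (act q (act (q [^]\<^bsub>Q\<^esub> n) x)) (act q (x \<otimes> y [^] n))"
    by (rule cong_mod_act[OF q Suc])
  moreover have "cong_mod K (act q (x \<otimes> y [^] n)) ((x \<otimes> y) \<otimes> y [^] n)"
  proof -
    have "cong_mod K (act q (y [^] n)) (y [^] n)"
    proof (induction n)
      case 0
      have "act q \<one> = \<one>"
        by (rule group_hom.hom_one[of M M]) (unfold_locales, rule act_hom[OF q])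
      then show ?case by (simp add: cong_mod_refl)
    next
      case (Suc n)
      then show ?case using cong_mod_mult[OF Suc qy] q y by (simp add: act_m)
    qed
    then show ?thesis using cong_mod_mult[OF qx] q x y by (simp add: act_m)
  qed
  moreover have "(x \<otimes> y) \<otimes> y [^] n = x \<otimes> y [^] Suc n"
    using x y by (simp add: m_ac)
  ultimately show ?case using cong_mod_trans by metis
qed

end

text \<open>Both clauses concern M/K; they are proved by one induction, in which the second for K
  rests on torsion control in M/K. The bound \<open>D \<ge> 1\<close> excludes the void case D = 0,
  where only the exponent 1 is tested.\<close>

definition rigid :: "'a set \<Rightarrow> nat \<Rightarrow> bool" where
  "rigid K D \<longleftrightarrow> D \<ge> 1 \<and> (\<forall>x\<in>carrier M. \<forall>j.
      (x [^] (1 + D * j) \<in> K \<longrightarrow> x \<in> K) \<and>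
      (\<forall>q\<in>carrier Q. x \<in> fixmod K (q [^]\<^bsub>Q\<^esub> (1 + D * j)) \<longrightarrow> x \<in> fixmod K q))"

lemma rigid_pos: "rigid K D \<Longrightarrow> D \<ge> 1"
  by (simp only: rigid_def)

lemma rigidD:
  assumes "rigid K D" "x \<in> carrier M"
  shows "x [^] (1 + D * j) \<in> K \<Longrightarrow> x \<in> K"
    "q \<in> carrier Q \<Longrightarrow> x \<in> fixmod K (q [^]\<^bsub>Q\<^esub> (1 + D * j)) \<Longrightarrow> x \<in> fixmod K q"
  using assms unfolding rigid_def by blast+

lemma rigid_mult:
  assumes "rigid K D" "E \<ge> 1"
  shows "rigid K (D * E)"
  unfolding rigid_def
proof (intro conjI ballI allI)
  show "1 \<le> D * E" using assms by (simp add: rigid_def)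
  fix x j assume "x \<in> carrier M"
  then have "(x [^] (1 + D * (E * j)) \<in> K \<longrightarrow> x \<in> K) \<and>
      (\<forall>q\<in>carrier Q. x \<in> fixmod K (q [^]\<^bsub>Q\<^esub> (1 + D * (E * j))) \<longrightarrow> x \<in> fixmod K q)"
    using assms(1) unfolding rigid_def by blast
  then show "x [^] (1 + D * E * j) \<in> K \<longrightarrow> x \<in> K"
    and "\<And>q. q \<in> carrier Q \<Longrightarrow> x \<in> fixmod K (q [^]\<^bsub>Q\<^esub> (1 + D * E * j)) \<longrightarrow> x \<in> fixmod K q"
    by (simp_all only: mult.assoc) blast+
qed

lemma rigid_Int:
  assumes "rigid K D" "rigid L D"
  shows "rigid (K \<inter> L) D"
proof -
  have "fixmod (K \<inter> L) q = fixmod K q \<inter> fixmod L q" for q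
    by (auto simp: fixmod_def cong_mod_def)
  then show ?thesis using assms unfolding rigid_def by blast
qed

text \<open>Noetherian induction in the spirit of primary decomposition. A reducible K inherits D
  from two larger submodules. If K is irreducible, any two larger submodules meet beyond K. A
  maximal group of elements with trivial e-th power on some L/K then stays the same when L shrinks,
  which reduces the claim to the rigidity of L, the exponent e and the torsion of M/K.\<close>

lemma ex_rigid:
  assumes accM: "acc submodules" and accQ: "acc {S. subgroup S Q \<and> act_kernel \<subseteq> S}"
    and K: "K \<in> submodules"
  shows "\<exists>D. rigid K D"
  using accM K
proof (induction rule: acc_induct)
  case (step K)
  note K = \<open>K \<in> submodules\<close>
  show ?case
  proof (cases "K = carrier M")
    case True
    then have "rigid K 1"
      using fixmod_submodule(2)[OF K] unfolding rigid_def by auto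
    then show ?thesis ..
  next
    case proper: False
    show ?thesis
    proof (cases "\<exists>L1\<in>submodules. \<exists>L2\<in>submodules. K \<subset> L1 \<and> K \<subset> L2 \<and> L1 \<inter> L2 = K")
      case True
      then obtain L1 L2 where L: "L1 \<in> submodules" "L2 \<in> submodules" "K \<subset> L1" "K \<subset> L2" "L1 \<inter> L2 = K"
        by blast
      obtain D1 where D1: "rigid L1 D1" using step.IH[OF L(1,3)] ..
      obtain D2 where D2: "rigid L2 D2" using step.IH[OF L(2,4)] ..
      have "rigid L1 (D1 * D2)" by (rule rigid_mult[OF D1 rigid_pos[OF D2]])
      moreover have "rigid L2 (D1 * D2)"
        using rigid_mult[OF D2 rigid_pos[OF D1]] by (simp only: mult.commute)
      ultimately have "rigid (L1 \<inter> L2) (D1 * D2)" by (rule rigid_Int)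
      then show ?thesis unfolding L(5) ..
    next
      case False
      have uniform: "K \<subset> L1 \<inter> L2"
        if "L1 \<in> submodules" "L2 \<in> submodules" "K \<subset> L1" "K \<subset> L2" for L1 L2
        using False that by blast
      interpret K: subgroup K M by (rule submoduleD(1)[OF K])
      \<comment> \<open>If n kills a nonzero class of M/K, the classes killed by n come from a
        larger submodule L with its own D. An element whose power 1 + n * D * j is in K then lies in
        L, so its power n * D * j is in K as well, and so is the element.\<close>
      have "\<exists>T :: nat. T \<ge> 1 \<and> (\<forall>x\<in>carrier M. \<forall>j. x [^] (1 + T * j) \<in> K \<longrightarrow> x \<in> K)"
      proof (cases "\<exists>n\<ge>1. \<exists>x\<in>carrier M. x \<notin> K \<and> x [^] (n :: nat) \<in> K")
        case True
        then obtain n x where n: "(n :: nat) \<ge> 1" and x: "x \<in> carrier M" "x \<notin> K" "x [^] n \<in> K" by blast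
        define L where "L = {x \<in> carrier M. x [^] n \<in> K}"
        have "L \<in> submodules"
        proof (rule submoduleI)
          show "subgroup L M"
          proof (rule subgroupI)
            show "L \<subseteq> carrier M" by (auto simp: L_def)
            have "\<one> \<in> L" by (simp add: L_def)
            then show "L \<noteq> {}" by blast
          qed (auto simp: L_def nat_pow_distrib nat_pow_inv)
          fix q y assume q: "q \<in> carrier Q" and "y \<in> L"
          then have y: "y \<in> carrier M" "y [^] n \<in> K" by (auto simp: L_def)
          have "cong_mod K (act q y [^] n) \<one>"
          proof -
            have "act q (y [^] m) = act q y [^] m" for m :: nat
              by (rule group_hom.hom_nat_pow[of M M]) (unfold_locales, use act_hom q y in auto)
            then show ?thesis using submoduleD(3)[OF K q y(2)] q y by (simp add: cong_mod_one[OF K])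
          qed
          then show "act q y \<in> L" using q y by (simp add: L_def cong_mod_one[OF K])
        qed
        moreover have "K \<subset> L"
        proof
          show "K \<subseteq> L"
          proof
            fix y assume y: "y \<in> K"
            then have "y [^] n \<in> K" by (induction n) auto
            with y show "y \<in> L" by (simp add: L_def)
          qed
          show "K \<noteq> L" using x by (auto simp: L_def)
        qed
        ultimately obtain D where D: "rigid L D" using step.IH by blast
        have "y \<in> K" if y: "y \<in> carrier M" "y [^] (1 + n * D * j) \<in> K" for y j
        proof -
          have comm: "1 + n * D * j = 1 + D * (n * j)" by simp
          have "y [^] (1 + D * (n * j)) \<in> K" using y(2) unfolding comm .
          moreover have "z \<in> L" if "z \<in> K" for z using \<open>K \<subset> L\<close> that by blast
          ultimately have "y \<in> L" using D y(1) unfolding rigid_def by blast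
          then have "y [^] n \<in> K" by (simp add: L_def)
          then have "(y [^] n) [^] int (D * j) \<in> K"
            by (rule subgroup_int_pow_closed[OF submoduleD(1)[OF K]])
          then have "(y [^] n) [^] (D * j) \<in> K" by (simp only: int_pow_int)
          then have k: "y [^] (n * D * j) \<in> K" using y(1) by (simp add: nat_pow_pow mult.assoc)
          have "y [^] (n * D * j) \<otimes> y \<in> K" using y by simp
          then have "inv (y [^] (n * D * j)) \<otimes> (y [^] (n * D * j) \<otimes> y) \<in> K" using k by blast
          then show "y \<in> K" using y(1) by (simp add: m_assoc[symmetric])
        qed
        note torsion = this
        show ?thesis
        proof (intro exI[of _ "n * D"] conjI ballI allI impI)
          show "1 \<le> n * D" using n rigid_pos[OF D] by simp
        qed (rule torsion)
      next
        case False
        show ?thesis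
        proof (intro exI[of _ 1] conjI ballI allI impI)
          fix x and j :: nat assume "x \<in> carrier M" "x [^] (1 + 1 * j) \<in> K"
          moreover have "1 + 1 * j \<ge> 1" by simp
          ultimately show "x \<in> K" using False by blast
        qed simp
      qed
      then obtain T :: nat where T: "T \<ge> 1"
        and torsion: "\<And>x j. x \<in> carrier M \<Longrightarrow> x [^] (1 + T * j) \<in> K \<Longrightarrow> x \<in> K" by blast
      \<comment> \<open>Maximality is sought over L and e together; the chain condition on subgroups
        above the kernel provides it.\<close>
      define \<S> where "\<S> = {power_stabilizer K L e | L e. L \<in> submodules \<and> K \<subset> L \<and> e \<ge> 1}"
      have "\<S> \<subseteq> {S. subgroup S Q \<and> act_kernel \<subseteq> S}"
      proof
        fix S assume "S \<in> \<S>"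
        then obtain L e where S: "S = power_stabilizer K L e" and "L \<in> submodules"
          unfolding \<S>_def by blast
        with power_stabilizer_subgroup[OF K submoduleD(2)[OF this(2)], of e]
        show "S \<in> {S. subgroup S Q \<and> act_kernel \<subseteq> S}" unfolding S mem_Collect_eq by (intro conjI)
      qed
      moreover have "power_stabilizer K (carrier M) 1 \<in> \<S>"
        using proper submodule_carrier K.subset unfolding \<S>_def by blast
      then have "\<S> \<noteq> {}" by blast
      ultimately have "\<exists>B\<in>\<S>. \<forall>C\<in>\<S>. B \<subseteq> C \<longrightarrow> C = B" by (rule acc_maximal[OF accQ])
      then obtain L e where L: "L \<in> submodules" "K \<subset> L" "e \<ge> 1"
        and max: "\<forall>C\<in>\<S>. power_stabilizer K L e \<subseteq> C \<longrightarrow> C = power_stabilizer K L e"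
        unfolding \<S>_def by blast
      obtain D where D: "rigid L D" using step.IH[OF L(1,2)] ..
      \<comment> \<open>One factor for each use: D for the rigidity of L, e to make q^(n - 1)
        trivial on L/K, and T for torsion in M/K.\<close>
      have "rigid K (D * e * T)"
        unfolding rigid_def
      proof (intro conjI ballI allI impI)
        show "1 \<le> D * e * T" using rigid_pos[OF D] L(3) T by simp
        fix x j assume x: "x \<in> carrier M"
        have n1: "1 + D * e * T * j = 1 + D * (e * T * j)"
          and n2: "1 + D * e * T * j = 1 + T * (D * e * j)"
          and n3: "1 + D * e * T * j = Suc (e * (D * T * j))" by simp_all
        show "x \<in> K" if "x [^] (1 + D * e * T * j) \<in> K"
          using torsion[OF x] that unfolding n2 by blast
        fix q assume q: "q \<in> carrier Q" and xq: "x \<in> fixmod K (q [^]\<^bsub>Q\<^esub> (1 + D * e * T * j))"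
        define n where "n = 1 + D * e * T * j"
        note xq = xq[folded n_def]
        have qn: "q [^]\<^bsub>Q\<^esub> i \<in> carrier Q" for i :: nat using q by simp
        show "x \<in> fixmod K q"
        proof (cases "x \<in> K")
          case True
          then show ?thesis using fixmod_submodule(2)[OF K q] by blast
        next
          case False
          let ?F = "fixmod K (q [^]\<^bsub>Q\<^esub> n)"
          have F: "?F \<in> submodules" "K \<subset> ?F"
            using fixmod_submodule[OF K qn[of n]] xq False by auto
          have L': "L \<inter> ?F \<in> submodules" "K \<subset> L \<inter> ?F"
            using submodule_Int[OF L(1) F(1)] uniform[OF L(1) F(1) L(2) F(2)] by auto
          \<comment> \<open>Shrinking L to its part fixed by q^n and multiplying the exponent by n
            can only enlarge the group, so maximality forces equality. Since q visibly belongs to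
            the new group, q^e acts trivially on all of L/K.\<close>
          let ?S = "power_stabilizer K (L \<inter> ?F) (e * n)"
          have "e * n \<ge> 1" using L(3) by (simp add: n_def)
          then have "?S \<in> \<S>" using L' unfolding \<S>_def by blast
          moreover have "power_stabilizer K L e \<subseteq> ?S"
          proof
            fix p assume "p \<in> power_stabilizer K L e"
            then have p: "p \<in> carrier Q" "L \<subseteq> fixmod K (p [^]\<^bsub>Q\<^esub> e)"
              by (auto simp: power_stabilizer_def)
            have "L \<subseteq> fixmod K ((p [^]\<^bsub>Q\<^esub> e) [^]\<^bsub>Q\<^esub> n)"
              using p fixmod_pow[OF K, of "p [^]\<^bsub>Q\<^esub> e"] by (meson Q.nat_pow_closed subset_iff)
            then show "p \<in> ?S" using p(1) unfolding power_stabilizer_def Q.nat_pow_pow[OF p(1)] by blast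
          qed
          ultimately have S: "?S = power_stabilizer K L e" using max by blast
          have "?F \<subseteq> fixmod K ((q [^]\<^bsub>Q\<^esub> n) [^]\<^bsub>Q\<^esub> e)"
            using fixmod_pow[OF K qn] by blast
          then have "q \<in> ?S"
            using q unfolding power_stabilizer_def Q.nat_pow_pow[OF q] by (auto simp only: mult.commute)
          then have qe: "L \<subseteq> fixmod K (q [^]\<^bsub>Q\<^esub> e)" unfolding S by (simp add: power_stabilizer_def)
          have "x \<in> fixmod L (q [^]\<^bsub>Q\<^esub> n)"
            using xq L(2) by (auto simp: fixmod_def cong_mod_def)
          then have xL: "x \<in> fixmod L q"
            using D x q unfolding rigid_def n_def n1 by blast
          \<comment> \<open>The displacement of x under q lies in L, where q^(n - 1) is trivial
            modulo K, and in \<open>?F\<close>, where q^n is. Hence q fixes y modulo K, and the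
            unipotent computation applies.\<close>
          define y where "y = act q x \<otimes> inv x"
          have y: "y \<in> L" "y \<in> carrier M" using xL q x by (auto simp: fixmod_def cong_mod_def y_def)
          have yF: "y \<in> ?F"
          proof -
            interpret F: subgroup ?F M by (rule submoduleD(1)[OF F(1)])
            show ?thesis using submoduleD(3)[OF F(1) q xq] xq by (auto simp: y_def)
          qed
          have "y \<in> fixmod K ((q [^]\<^bsub>Q\<^esub> e) [^]\<^bsub>Q\<^esub> (D * T * j))"
            using fixmod_pow[OF K qn] qe y(1) by blast
          then have ye: "cong_mod K (act (q [^]\<^bsub>Q\<^esub> (e * (D * T * j))) y) y"
            unfolding Q.nat_pow_pow[OF q] by (simp add: fixmod_def)
          have "act (q [^]\<^bsub>Q\<^esub> n) y = act q (act (q [^]\<^bsub>Q\<^esub> (e * (D * T * j))) y)"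
            unfolding n_def n3 using q y by (simp add: act_mult act_commute)
          then have "cong_mod K (act (q [^]\<^bsub>Q\<^esub> n) y) (act q y)"
            using cong_mod_act[OF K q ye] by simp
          moreover have "cong_mod K (act (q [^]\<^bsub>Q\<^esub> n) y) y" using yF by (simp add: fixmod_def)
          ultimately have qy: "cong_mod K (act q y) y"
            using cong_mod_trans[OF K cong_mod_sym[OF K]] by blast
          have qx: "act q x = x \<otimes> y"
            using q x by (simp add: y_def m_lcomm[of x "act q x"])
          have "cong_mod K (act (q [^]\<^bsub>Q\<^esub> n) x) (x \<otimes> y [^] n)"
            by (rule unipotent_step[OF K q x y(2) _ qy]) (use qx cong_mod_refl[OF K] x y in simp)
          moreover have "cong_mod K (act (q [^]\<^bsub>Q\<^esub> n) x) x" using xq by (simp add: fixmod_def)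
          ultimately have "cong_mod K (x \<otimes> y [^] n) x" using cong_mod_trans[OF K cong_mod_sym[OF K]] by blast
          then have "y [^] n \<in> K" using cong_mod_cancel[OF K x, of "y [^] n"] y(2) by blast
          then have "y \<in> K" using torsion[OF y(2)] unfolding n_def n2 by blast
          then show ?thesis using q x by (simp add: fixmod_def cong_mod_def y_def)
        qed
      qed
      then show ?thesis ..
    qed
  qed
qed

end

section \<open>Finitely generated metabelian groups\<close>

context group
begin

text \<open>Membership in the carrier is part of the relation, so that closure conditions travel
  with it.\<close>

definition commutes :: "'a \<Rightarrow> 'a \<Rightarrow> bool" where
  "commutes x y \<longleftrightarrow> x \<in> carrier G \<and> y \<in> carrier G \<and> x \<otimes> y = y \<otimes> x"

lemma inv_cancel:
  assumes "x \<in> carrier G" "y \<in> carrier G"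
  shows "inv x \<otimes> (x \<otimes> y) = y" "x \<otimes> (inv x \<otimes> y) = y"
  using assms by (simp_all add: m_assoc[symmetric])

lemma commutes_closed: "commutes x y \<Longrightarrow> x \<in> carrier G" "commutes x y \<Longrightarrow> y \<in> carrier G"
  by (simp_all add: commutes_def)

lemma commutes_sym: "commutes x y \<Longrightarrow> commutes y x"
  by (simp add: commutes_def)

lemma commutes_one: "x \<in> carrier G \<Longrightarrow> commutes x \<one>"
  by (simp add: commutes_def)

lemma commutes_mult:
  assumes "commutes x y" "commutes x z"
  shows "commutes x (y \<otimes> z)"
proof -
  have c: "x \<in> carrier G" "y \<in> carrier G" "z \<in> carrier G" "x \<otimes> y = y \<otimes> x" "x \<otimes> z = z \<otimes> x"
    using assms by (auto simp: commutes_def)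
  have "x \<otimes> (y \<otimes> z) = y \<otimes> x \<otimes> z" using c(1-3) by (simp only: m_assoc[symmetric] c(4))
  also have "\<dots> = y \<otimes> z \<otimes> x" using c(1-3) by (simp only: m_assoc c(5))
  finally show ?thesis using c(1-3) by (simp add: commutes_def)
qed

lemma commutes_inv:
  assumes "commutes x y"
  shows "commutes x (inv y)"
proof -
  have c: "x \<in> carrier G" "y \<in> carrier G" "x \<otimes> y = y \<otimes> x" using assms by (auto simp: commutes_def)
  have "inv y \<otimes> (x \<otimes> y) \<otimes> inv y = inv y \<otimes> (y \<otimes> x) \<otimes> inv y" by (simp only: c)
  then have "inv y \<otimes> x = x \<otimes> inv y" using c(1,2) by (simp add: m_assoc inv_cancel)
  then show ?thesis using c by (simp add: commutes_def)
qed

lemma commutes_pow: "commutes x y \<Longrightarrow> commutes x (y [^] (n :: nat))"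
  by (induction n) (auto simp: commutes_closed intro: commutes_one commutes_mult)

lemma commutes_generate:
  assumes "u \<in> generate G S" "x \<in> carrier G" "\<And>s. s \<in> S \<Longrightarrow> commutes x s"
  shows "commutes x u"
  using assms(1) by induction (auto intro: assms commutes_one commutes_inv commutes_mult)

lemma commutes_iff_conj: "x \<in> carrier G \<Longrightarrow> y \<in> carrier G \<Longrightarrow> commutes x y \<longleftrightarrow> x \<otimes> y \<otimes> inv x = y"
  using inv_solve_right'[of y "x \<otimes> y" x] by (auto simp: commutes_def)

lemma commutator_swap:
  assumes "a \<in> carrier G" "b \<in> carrier G"
  shows "a \<otimes> b = (a \<otimes> b \<otimes> inv a \<otimes> inv b) \<otimes> b \<otimes> a"
  using assms by (simp add: m_assoc inv_cancel)

text \<open>The computation in the Heisenberg group: moving one a past one b costs a factor x, which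
  can be collected on the left, and i times j such moves are needed.\<close>

lemma central_commutator_power:
  assumes a: "a \<in> carrier G" and b: "b \<in> carrier G" and x: "commutes x a" "commutes x b"
    and ab: "a \<otimes> b = x \<otimes> b \<otimes> a"
  shows "a [^] (i :: nat) \<otimes> b [^] (j :: nat) = x [^] (i * j) \<otimes> b [^] j \<otimes> a [^] i"
proof -
  have xc: "x \<in> carrier G" using x by (rule_tac commutes_closed)
  have xp: "commutes (x [^] k) a" "commutes (x [^] k) b" for k :: nat
    using commutes_pow[of a x] commutes_pow[of b x] x commutes_sym by blast+
  have one: "a [^] i \<otimes> b = x [^] i \<otimes> b \<otimes> a [^] i"
  proof (induction i)
    case (Suc i)
    have "a [^] Suc i \<otimes> b = a [^] i \<otimes> (x \<otimes> b \<otimes> a)"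
      using a b by (simp add: m_assoc ab)
    also have "\<dots> = x \<otimes> (a [^] i \<otimes> b) \<otimes> a"
    proof -
      have xa: "a [^] i \<otimes> x = x \<otimes> a [^] i"
        using commutes_pow[OF x(1), of i] by (simp add: commutes_def)
      have "a [^] i \<otimes> (x \<otimes> b \<otimes> a) = (a [^] i \<otimes> x) \<otimes> b \<otimes> a"
        using a b xc by (simp add: m_assoc)
      then show ?thesis unfolding xa using a b xc by (simp add: m_assoc)
    qed
    also have "\<dots> = x \<otimes> x [^] i \<otimes> b \<otimes> (a [^] i \<otimes> a)"
      unfolding Suc using a b xc by (simp add: m_assoc)
    also have "x \<otimes> x [^] i = x [^] Suc i" using xc nat_pow_Suc2 by simp
    finally show ?case by simp
  qed (use b in simp)
  show ?thesis
  proof (induction j)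
    case (Suc j)
    have "a [^] i \<otimes> b [^] Suc j = (a [^] i \<otimes> b [^] j) \<otimes> b"
      using a b by (simp add: m_assoc)
    also have "\<dots> = x [^] (i * j) \<otimes> b [^] j \<otimes> (a [^] i \<otimes> b)"
      unfolding Suc using a b xc by (simp add: m_assoc)
    also have "\<dots> = x [^] (i * j) \<otimes> (b [^] j \<otimes> x [^] i) \<otimes> b \<otimes> a [^] i"
      unfolding one using a b xc by (simp add: m_assoc)
    also have "b [^] j \<otimes> x [^] i = x [^] i \<otimes> b [^] j"
      using commutes_pow[OF xp(2)[of i], of j] by (simp add: commutes_def)
    also have "x [^] (i * j) \<otimes> (x [^] i \<otimes> b [^] j) \<otimes> b \<otimes> a [^] i
        = (x [^] (i * j) \<otimes> x [^] i) \<otimes> (b [^] j \<otimes> b) \<otimes> a [^] i"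
      using a b xc by (simp add: m_assoc)
    also have "x [^] (i * j) \<otimes> x [^] i = x [^] (i * Suc j)"
      using xc by (simp add: nat_pow_mult add.commute)
    finally show ?case by simp
  qed (use a in simp)
qed

text \<open>G/A is abelian because its generators commute. Commuting modulo A, written
  \<open>R\<close>, extends from Y to G in one argument and then, by symmetry, in the other.\<close>

lemma derived_subset_normal:
  assumes A: "A \<lhd> G" and Y: "Y \<subseteq> carrier G" "generate G Y = carrier G"
    and comm: "\<And>x y. x \<in> Y \<Longrightarrow> y \<in> Y \<Longrightarrow> x \<otimes> y \<otimes> inv x \<otimes> inv y \<in> A"
  shows "derived G (carrier G) \<subseteq> A"
proof -
  interpret A: normal A G by (rule A)
  define R where "R g h \<longleftrightarrow> g \<otimes> h \<otimes> inv g \<otimes> inv h \<in> A" for g h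
  have R_sym: "R h g" if "R g h" "g \<in> carrier G" "h \<in> carrier G" for g h
  proof -
    have "inv (g \<otimes> h \<otimes> inv g \<otimes> inv h) \<in> A" using that by (simp add: R_def)
    also have "inv (g \<otimes> h \<otimes> inv g \<otimes> inv h) = h \<otimes> g \<otimes> inv h \<otimes> inv g"
      using that by (simp add: inv_mult_group m_assoc)
    finally show ?thesis by (simp add: R_def)
  qed
  have R_gen: "R g h" if "g \<in> generate G Y" and h: "h \<in> carrier G" and "\<And>x. x \<in> Y \<Longrightarrow> R x h" for g h
    using that(1)
  proof (induction rule: generate.induct)
    case one
    then show ?case using h by (simp add: R_def)
  next
    case (incl x)
    then show ?case using that by blast
  next
    case (inv x)
    then have x: "x \<in> carrier G" "R x h" using that Y by auto
    have "inv x \<otimes> inv (x \<otimes> h \<otimes> inv x \<otimes> inv h) \<otimes> x \<in> A"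
      by (rule A.inv_op_closed1[OF x(1) A.m_inv_closed[OF x(2)[unfolded R_def]]])
    also have "inv x \<otimes> inv (x \<otimes> h \<otimes> inv x \<otimes> inv h) \<otimes> x = inv x \<otimes> h \<otimes> inv (inv x) \<otimes> inv h"
      using x h by (simp add: inv_mult_group m_assoc inv_cancel)
    finally show ?case by (simp add: R_def)
  next
    case (eng g1 g2)
    then have g: "g1 \<in> carrier G" "g2 \<in> carrier G" using Y generate_in_carrier by auto
    have "(g1 \<otimes> (g2 \<otimes> h \<otimes> inv g2 \<otimes> inv h) \<otimes> inv g1) \<otimes> (g1 \<otimes> h \<otimes> inv g1 \<otimes> inv h) \<in> A"
      by (rule A.m_closed[OF A.inv_op_closed2[OF g(1) eng.IH(2)[unfolded R_def]] eng.IH(1)[unfolded R_def]])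
    also have "(g1 \<otimes> (g2 \<otimes> h \<otimes> inv g2 \<otimes> inv h) \<otimes> inv g1) \<otimes> (g1 \<otimes> h \<otimes> inv g1 \<otimes> inv h)
        = g1 \<otimes> g2 \<otimes> h \<otimes> inv (g1 \<otimes> g2) \<otimes> inv h"
      using g h by (simp add: inv_mult_group m_assoc inv_cancel)
    finally show ?case by (simp add: R_def)
  qed
  have "R x h" if "x \<in> Y" "h \<in> carrier G" for x h
    using R_sym[OF R_gen[of h x]] that Y comm by (auto simp: R_def)
  then have "R g h" if "g \<in> carrier G" "h \<in> carrier G" for g h
    using R_gen[of g h] that Y(2) by blast
  then have "(\<Union>g\<in>carrier G. \<Union>h\<in>carrier G. {g \<otimes> h \<otimes> inv g \<otimes> inv h}) \<subseteq> A"
    by (auto simp: R_def)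
  then show ?thesis
    unfolding derived_def by (rule generate_subgroup_incl[OF _ A.subgroup_axioms])
qed

text \<open>Conjugation by x could map A properly into itself, so the inverses of the generators are
  tested too.\<close>

lemma normal_if_generators_normalize:
  assumes A: "subgroup A G" and Y: "Y \<subseteq> carrier G" "generate G Y = carrier G"
    and inv: "\<And>x a. x \<in> Y \<union> m_inv G ` Y \<Longrightarrow> a \<in> A \<Longrightarrow> x \<otimes> a \<otimes> inv x \<in> A"
  shows "A \<lhd> G"
proof -
  have "\<forall>a\<in>A. g \<otimes> a \<otimes> inv g \<in> A" if "g \<in> generate G Y" for g
    using that
  proof (induction rule: generate.induct)
    case one
    then show ?case using subgroup.mem_carrier[OF A] by auto
  next
    case (eng g1 g2)
    then have g: "g1 \<in> carrier G" "g2 \<in> carrier G" using Y generate_in_carrier by auto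
    have "g1 \<otimes> g2 \<otimes> a \<otimes> inv (g1 \<otimes> g2) = g1 \<otimes> (g2 \<otimes> a \<otimes> inv g2) \<otimes> inv g1" if "a \<in> A" for a
      using g subgroup.mem_carrier[OF A that] by (simp add: inv_mult_group m_assoc)
    with eng show ?case by simp
  qed (use inv in auto)
  then show ?thesis using A Y by (auto simp: normal_inv_iff)
qed

lemma group_hom_FactGroup: "N \<lhd> G \<Longrightarrow> group_hom G (G Mod N) ((#>) N)"
  by (intro group_hom.intro group_hom_axioms.intro normal.r_coset_hom_Mod
      normal.factorgroup_is_group group_axioms)

lemma generate_FactGroup:
  assumes "N \<lhd> G" "Y \<subseteq> carrier G"
  shows "generate (G Mod N) ((#>) N ` Y) = (#>) N ` generate G Y"
proof -
  interpret group_hom G "G Mod N" "(#>) N"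
    by (rule group_hom_FactGroup[OF assms(1)])
  show ?thesis using generate_img[OF assms(2)] by simp
qed

text \<open>Such subgroups correspond to subgroups of the finitely generated abelian group G/N, a
  Noetherian module over the empty set of operators.\<close>

lemma acc_supergroups:
  assumes N: "N \<lhd> G" and comm: "comm_group (G Mod N)"
    and Y: "finite Y" "Y \<subseteq> carrier G" "generate G Y = carrier G"
  shows "acc {S. subgroup S G \<and> N \<subseteq> S}"
proof -
  let ?Q = "G Mod N"
  let ?\<pi> = "(#>) N"
  interpret Q: comm_group ?Q by (rule comm)
  interpret \<pi>: group_hom G ?Q ?\<pi>
    by (rule group_hom_FactGroup[OF N])
  interpret N: normal N G by (rule N)
  have "?\<pi> ` Y \<subseteq> carrier ?Q" using Y(2) by (auto simp: carrier_FactGroup)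
  then have "\<exists>A \<in> inv_subgroups ?Q {} (carrier ?Q). ?\<pi> ` Y \<subseteq> A \<and> acc (inv_subgroups ?Q {} A)"
    using Y(1) by (intro Q.ex_acc_module) auto
  then obtain A where A: "subgroup A ?Q" "?\<pi> ` Y \<subseteq> A" "acc (inv_subgroups ?Q {} A)"
    by (auto simp: inv_subgroups_def)
  have "generate ?Q (?\<pi> ` Y) \<subseteq> A" by (rule Q.generate_subgroup_incl[OF A(2,1)])
  then have "A = carrier ?Q"
    using subgroup.subset[OF A(1)] by (simp add: generate_FactGroup[OF N Y(2)] Y(3) carrier_FactGroup)
  with A(3) have acc: "acc (inv_subgroups ?Q {} (carrier ?Q))" by simp
  show ?thesis
    unfolding acc_def
  proof (intro allI impI, elim conjE)
    fix f :: "nat \<Rightarrow> 'a set"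
    assume f: "\<forall>i. f i \<in> {S. subgroup S G \<and> N \<subseteq> S}" and mono: "\<forall>i. f i \<subseteq> f (Suc i)"
    have sub: "subgroup (f i) G" "N \<subseteq> f i" for i using f by auto
    have "subgroup (?\<pi> ` f i) ?Q" for i by (rule \<pi>.subgroup_img_is_subgroup[OF sub(1)])
    then have "?\<pi> ` f i \<in> inv_subgroups ?Q {} (carrier ?Q)" for i
      using subgroup.subset unfolding inv_subgroups_def by blast
    moreover have "?\<pi> ` f i \<subseteq> ?\<pi> ` f (Suc i)" for i using mono by (intro image_mono) simp
    ultimately have "\<exists>n. \<forall>m\<ge>n. ?\<pi> ` f m = ?\<pi> ` f n" by (rule accD[OF acc])
    then obtain n where n: "\<forall>m\<ge>n. ?\<pi> ` f m = ?\<pi> ` f n" ..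
    \<comment> \<open>All members contain N, so they are recovered from their images in G/N.\<close>
    have incl: "f i \<subseteq> f j" if eq: "?\<pi> ` f i = ?\<pi> ` f j" for i j
    proof
      fix g assume g: "g \<in> f i"
      then have gc: "g \<in> carrier G" using subgroup.mem_carrier[OF sub(1)] by blast
      obtain h where h: "h \<in> f j" "N #> g = N #> h" using g eq by blast
      have "g \<in> N #> h" using rcos_self[OF gc N.subgroup_axioms] h(2) by simp
      then obtain y where "y \<in> N" "g = y \<otimes> h" by (auto simp: r_coset_def)
      then show "g \<in> f j" using h(1) sub(2)[of j] subgroup.m_closed[OF sub(1)] by blast
    qed
    have "\<forall>m\<ge>n. f m = f n"
    proof (intro allI impI subset_antisym)
      fix m assume "n \<le> m"
      with n have eq: "?\<pi> ` f m = ?\<pi> ` f n" by blast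
      show "f m \<subseteq> f n" by (rule incl[OF eq])
      show "f n \<subseteq> f m" by (rule incl[OF eq[symmetric]])
    qed
    then show "\<exists>n. \<forall>m\<ge>n. f m = f n" ..
  qed
qed

section \<open>The derived subgroup of a metabelian group as a module under conjugation\<close>

lemma derived_set_closed_commutator:
  assumes "a \<in> carrier G" "b \<in> carrier G"
  shows "a \<otimes> b \<otimes> inv a \<otimes> inv b \<in> derived G (carrier G)"
  unfolding derived_def using assms by (auto intro!: generate.incl)

lemma derived_normal: "derived G (carrier G) \<lhd> G"
  by (rule derived_is_normal[OF normal_self])

lemma derived_carrier: "x \<in> derived G (carrier G) \<Longrightarrow> x \<in> carrier G"
  using derived_in_carrier[OF subset_refl] by blast

lemma metabelian_comm_group:
  assumes abelian: "\<And>x y. x \<in> derived G (carrier G) \<Longrightarrow> y \<in> derived G (carrier G) \<Longrightarrow> x \<otimes> y = y \<otimes> x"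
  shows "comm_group (G\<lparr>carrier := derived G (carrier G)\<rparr>)"
  by (rule group.group_comm_groupI[OF subgroup_imp_group[OF normal_imp_subgroup[OF derived_normal]]])
    (simp add: abelian)

lemma conj_hom:
  assumes A: "A \<lhd> G" and q: "q \<in> carrier G"
  shows "(\<lambda>x. q \<otimes> x \<otimes> inv q) \<in> hom (G\<lparr>carrier := A\<rparr>) (G\<lparr>carrier := A\<rparr>)"
proof (rule homI)
  interpret A: normal A G by (rule A)
  show "q \<otimes> x \<otimes> inv q \<in> carrier (G\<lparr>carrier := A\<rparr>)" if "x \<in> carrier (G\<lparr>carrier := A\<rparr>)" for x
    using that A.inv_op_closed2[OF q] by simp
  show "q \<otimes> (x \<otimes>\<^bsub>G\<lparr>carrier := A\<rparr>\<^esub> y) \<otimes> inv q =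
      q \<otimes> x \<otimes> inv q \<otimes>\<^bsub>G\<lparr>carrier := A\<rparr>\<^esub> (q \<otimes> y \<otimes> inv q)"
    if "x \<in> carrier (G\<lparr>carrier := A\<rparr>)" "y \<in> carrier (G\<lparr>carrier := A\<rparr>)" for x y
    using that A.mem_carrier q by (simp add: m_assoc inv_cancel)
qed

lemma conj_mult:
  "q \<in> carrier G \<Longrightarrow> r \<in> carrier G \<Longrightarrow> x \<in> carrier G \<Longrightarrow>
    (q \<otimes> r) \<otimes> x \<otimes> inv (q \<otimes> r) = q \<otimes> (r \<otimes> x \<otimes> inv r) \<otimes> inv q"
  by (simp add: m_assoc inv_mult_group)

lemma metabelian_op_module:
  assumes abelian: "\<And>x y. x \<in> derived G (carrier G) \<Longrightarrow> y \<in> derived G (carrier G) \<Longrightarrow> x \<otimes> y = y \<otimes> x"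
  shows "op_module (G\<lparr>carrier := derived G (carrier G)\<rparr>) G (\<lambda>q x. q \<otimes> x \<otimes> inv q)"
proof (intro op_module.intro op_module_axioms.intro metabelian_comm_group abelian group_axioms
    conj_hom derived_normal)
  let ?M = "derived G (carrier G)"
  fix q r x assume q: "q \<in> carrier G" and r: "r \<in> carrier G"
    and "x \<in> carrier (G\<lparr>carrier := ?M\<rparr>)"
  then have x: "x \<in> ?M" "x \<in> carrier G" using derived_carrier by auto
  show "q \<otimes> r \<otimes> x \<otimes> inv (q \<otimes> r) = q \<otimes> (r \<otimes> x \<otimes> inv r) \<otimes> inv q"
    by (rule conj_mult[OF q r x(2)])
  \<comment> \<open>The products q r and r q differ by a commutator, which lies in the abelian group
    G' and therefore acts trivially on it.\<close>
  define c where "c = inv q \<otimes> inv r \<otimes> inv (inv q) \<otimes> inv (inv r)"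
  have c: "c \<in> ?M" unfolding c_def using q r by (intro derived_set_closed_commutator) auto
  have cc: "c \<in> carrier G" using derived_carrier[OF c] .
  have "commutes c x" using abelian[OF c x(1)] cc x(2) by (simp add: commutes_def)
  then have cx: "c \<otimes> x \<otimes> inv c = x" using commutes_iff_conj[OF cc x(2)] by simp
  have qr: "q \<otimes> r = (r \<otimes> q) \<otimes> c" unfolding c_def using q r by (simp add: m_assoc inv_cancel)
  have "q \<otimes> (r \<otimes> x \<otimes> inv r) \<otimes> inv q = (q \<otimes> r) \<otimes> x \<otimes> inv (q \<otimes> r)"
    by (rule conj_mult[OF q r x(2), symmetric])
  also have "\<dots> = (r \<otimes> q) \<otimes> (c \<otimes> x \<otimes> inv c) \<otimes> inv (r \<otimes> q)"
    unfolding qr using q r by (intro conj_mult cc x(2)) simp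
  also have "\<dots> = r \<otimes> (q \<otimes> x \<otimes> inv q) \<otimes> inv r"
    unfolding cx by (rule conj_mult[OF r q x(2)])
  finally show "q \<otimes> (r \<otimes> x \<otimes> inv r) \<otimes> inv q = r \<otimes> (q \<otimes> x \<otimes> inv q) \<otimes> inv r" .
qed (use derived_carrier in auto)

text \<open>P. Hall's theorem. The commutators of the generators lie in a submodule A that is
  Noetherian for the conjugations by the finitely many generators and their inverses. Such an A is
  normal in G and G/A is abelian, so A is all of G'.\<close>

lemma metabelian_acc:
  fixes act
  assumes abelian: "\<And>x y. x \<in> derived G (carrier G) \<Longrightarrow> y \<in> derived G (carrier G) \<Longrightarrow> x \<otimes> y = y \<otimes> x"
    and Y: "finite Y" "Y \<subseteq> carrier G" "generate G Y = carrier G"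
  defines "act \<equiv> \<lambda>q x. q \<otimes> x \<otimes> inv q"
  shows "acc (inv_subgroups (G\<lparr>carrier := derived G (carrier G)\<rparr>) (act ` carrier G)
    (derived G (carrier G)))"
proof -
  let ?M = "derived G (carrier G)"
  let ?MG = "G\<lparr>carrier := ?M\<rparr>"
  interpret M: op_module ?MG G act
    unfolding act_def by (rule metabelian_op_module[OF abelian])
  have sM: "subgroup ?M G" by (rule normal_imp_subgroup[OF derived_normal])
  define Z where "Z = Y \<union> m_inv G ` Y"
  define C where "C = (\<lambda>(x, y). x \<otimes> y \<otimes> inv x \<otimes> inv y) ` (Y \<times> Y)"
  have Z: "Z \<subseteq> carrier G" "finite (act ` Z)" using Y by (auto simp: Z_def)
  have C: "finite C" "C \<subseteq> carrier ?MG"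
    using Y derived_set_closed_commutator by (auto simp: C_def subset_iff)
  have hom: "act ` Z \<subseteq> hom ?MG ?MG" using M.act_hom Z by auto
  have "\<exists>A \<in> inv_subgroups ?MG (act ` Z) (carrier ?MG). C \<subseteq> A \<and> acc (inv_subgroups ?MG (act ` Z) A)"
  proof (rule comm_group.ex_acc_module[OF metabelian_comm_group[OF abelian] C Z(2) hom])
    fix f g x assume "f \<in> act ` Z" "g \<in> act ` Z" and x: "x \<in> carrier ?MG"
    then obtain q r where "f = act q" "g = act r" "q \<in> carrier G" "r \<in> carrier G" using Z by blast
    then show "f (g x) = g (f x)" using M.act_commute x by simp
  qed
  then obtain A where A: "A \<in> inv_subgroups ?MG (act ` Z) ?M" "C \<subseteq> A"
      "acc (inv_subgroups ?MG (act ` Z) A)" by auto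
  then have "subgroup A ?MG" by (simp add: inv_subgroups_def)
  then have sA: "subgroup A G" by (rule incl_subgroup[OF sM])
  have "A \<lhd> G"
  proof (rule normal_if_generators_normalize[OF sA Y(2,3)])
    fix x a assume "x \<in> Y \<union> m_inv G ` Y" "a \<in> A"
    then have "act x a \<in> A" using inv_subgroups_image[OF A(1)] by (auto simp: Z_def)
    then show "x \<otimes> a \<otimes> inv x \<in> A" by (simp add: act_def)
  qed
  then have "?M \<subseteq> A"
    by (rule derived_subset_normal[OF _ Y(2,3)]) (use A(2) in \<open>auto simp: C_def\<close>)
  then have "A = ?M" using A(1) by (auto simp: inv_subgroups_def)
  with A(3) have "acc (inv_subgroups ?MG (act ` Z) ?M)" by simp
  \<comment> \<open>Invariance under conjugation by all of G is a stronger demand than under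
    \<open>Z\<close>, so the family of submodules only shrinks.\<close>
  then show ?thesis
    by (rule acc_subset[OF _ inv_subgroups_antimono[OF image_mono[OF Z(1)]]])
qed

lemma metabelian_rigidity:
  assumes abelian: "\<And>x y. x \<in> derived G (carrier G) \<Longrightarrow> y \<in> derived G (carrier G) \<Longrightarrow> x \<otimes> y = y \<otimes> x"
    and Y: "finite Y" "Y \<subseteq> carrier G" "generate G Y = carrier G"
  obtains D :: nat where "D \<ge> 2"
    "\<And>x j. x \<in> derived G (carrier G) \<Longrightarrow> x [^] (1 + D * j) = \<one> \<Longrightarrow> x = \<one>"
    "\<And>x j q. x \<in> derived G (carrier G) \<Longrightarrow> q \<in> carrier G \<Longrightarrow> commutes (q [^] (1 + D * j)) x \<Longrightarrow> commutes q x"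
proof -
  let ?M = "derived G (carrier G)"
  let ?MG = "G\<lparr>carrier := ?M\<rparr>"
  define act where "act = (\<lambda>q x. q \<otimes> x \<otimes> inv q)"
  interpret M: op_module ?MG G act
    unfolding act_def by (rule metabelian_op_module[OF abelian])
  have accM: "acc M.submodules"
    using metabelian_acc[OF abelian Y] by (simp add: act_def)
  \<comment> \<open>An abelian G' acts trivially on itself, so subgroups above the kernel contain
    G', and G/G' is finitely generated abelian.\<close>
  have "?M \<subseteq> M.act_kernel"
  proof
    fix q assume q: "q \<in> ?M"
    then have "commutes q x" if "x \<in> ?M" for x
      using abelian[OF q that] derived_carrier that by (simp add: commutes_def)
    then show "q \<in> M.act_kernel"
      using q derived_carrier commutes_iff_conj by (simp add: act_def)
  qed
  then have accQ: "acc {S. subgroup S G \<and> M.act_kernel \<subseteq> S}"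
    by (intro acc_subset[OF acc_supergroups[OF derived_normal derived_quot_is_comm_group Y]]) auto
  have one: "{\<one>} \<in> M.submodules"
  proof (rule M.submoduleI)
    show "subgroup {\<one>} ?MG"
      using group.triv_subgroup[OF subgroup_imp_group[OF normal_imp_subgroup[OF derived_normal]]] by simp
  qed (simp add: act_def)
  obtain D0 where "M.rigid {\<one>} D0" using M.ex_rigid[OF accM accQ one] ..
  \<comment> \<open>Doubling yields the bound of 2 that the integer relations require.\<close>
  then have D: "M.rigid {\<one>} (D0 * 2)" by (rule M.rigid_mult) simp
  have "D0 * 2 \<ge> 2" using M.rigid_pos[OF \<open>M.rigid {\<one>} D0\<close>] by simp
  moreover have "x = \<one>" if "x \<in> ?M" "x [^] (1 + D0 * 2 * j) = \<one>" for x and j :: nat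
    using M.rigidD(1)[OF D, of x j] that by (simp add: nat_pow_consistent[symmetric])
  moreover have "commutes q x" if x: "x \<in> ?M" and q: "q \<in> carrier G"
    and "commutes (q [^] (1 + D0 * 2 * j)) x" for x q and j :: nat
  proof -
    have fix_iff: "x \<in> M.fixmod {\<one>} p \<longleftrightarrow> commutes p x" if p: "p \<in> carrier G" for p
    proof -
      have "x \<in> M.fixmod {\<one>} p \<longleftrightarrow> act p x = x"
        using x M.act_closed[OF p, of x] M.cong_mod_trivial[of "act p x" x] by (simp add: M.fixmod_def)
      also have "\<dots> \<longleftrightarrow> commutes p x"
        unfolding act_def using commutes_iff_conj[OF p derived_carrier[OF x]] ..
      finally show ?thesis .
    qed
    have "x \<in> M.fixmod {\<one>} (q [^] (1 + D0 * 2 * j))"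
      using that fix_iff by (meson nat_pow_closed)
    then have "x \<in> M.fixmod {\<one>} q" using x by (intro M.rigidD(2)[OF D _ q]) simp_all
    then show ?thesis using fix_iff q by blast
  qed
  ultimately show ?thesis by (rule that)
qed

text \<open>The redundancy found in G/G' lifts to G up to a factor m from G', while u still comes
  from the subgroup generated by the other elements.\<close>

lemma redundant_mod_derived:
  assumes Y: "finite Y" "Y \<subseteq> carrier G" "generate G Y = carrier G" and D: "(D :: nat) \<ge> 2"
  shows "\<exists>N :: nat. N \<ge> 1 \<and> (\<forall>v. (\<forall>l<N. v l \<in> carrier G) \<longrightarrow>
    (\<exists>k<N. \<exists>j :: nat. \<exists>m \<in> derived G (carrier G). \<exists>u \<in> generate G (v ` ({..<N} - {k})).
      v k [^] (1 + D * j) = m \<otimes> u))"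
proof -
  let ?M = "derived G (carrier G)"
  let ?Q = "G Mod ?M"
  let ?\<pi> = "(#>) ?M"
  interpret Q: comm_group ?Q by (rule derived_quot_is_comm_group)
  interpret \<pi>: group_hom G ?Q ?\<pi> by (rule group_hom_FactGroup[OF derived_normal])
  have \<pi>Y: "finite (?\<pi> ` Y)" "?\<pi> ` Y \<subseteq> carrier ?Q" "generate ?Q (?\<pi> ` Y) = carrier ?Q"
    using Y by (auto simp: generate_FactGroup[OF derived_normal] carrier_FactGroup)
  obtain N :: nat where N: "N \<ge> 1" "\<And>v. \<forall>l<N. v l \<in> carrier ?Q \<Longrightarrow>
      \<exists>k<N. \<exists>j :: nat. v k [^]\<^bsub>?Q\<^esub> (1 + D * j) \<in> generate ?Q (v ` ({..<N} - {k}))"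
    using Q.redundant_power[OF \<pi>Y D] by blast
  have "\<exists>k<N. \<exists>j :: nat. \<exists>m \<in> ?M. \<exists>u \<in> generate G (v ` ({..<N} - {k})). v k [^] (1 + D * j) = m \<otimes> u"
    if v: "\<forall>l<N. v l \<in> carrier G" for v
  proof -
    obtain k and j :: nat where k: "k < N"
      and kj: "?\<pi> (v k) [^]\<^bsub>?Q\<^esub> (1 + D * j) \<in> generate ?Q ((\<lambda>l. ?\<pi> (v l)) ` ({..<N} - {k}))"
      using N(2)[of "\<lambda>l. ?\<pi> (v l)"] v \<pi>.hom_closed by blast
    have vk: "v k \<in> carrier G" using v k by blast
    have sub: "v ` ({..<N} - {k}) \<subseteq> carrier G" using v by auto
    have "generate ?Q ((\<lambda>l. ?\<pi> (v l)) ` ({..<N} - {k})) = ?\<pi> ` generate G (v ` ({..<N} - {k}))"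
      using generate_FactGroup[OF derived_normal sub] by (simp only: image_image)
    moreover have "?\<pi> (v k) [^]\<^bsub>?Q\<^esub> (1 + D * j) = ?\<pi> (v k [^] (1 + D * j))"
      by (rule \<pi>.hom_nat_pow[OF vk, symmetric])
    ultimately obtain u where u: "u \<in> generate G (v ` ({..<N} - {k}))"
        "?M #> (v k [^] (1 + D * j)) = ?M #> u"
      using kj by auto
    have "v k [^] (1 + D * j) \<in> ?M #> u"
      using rcos_self[OF nat_pow_closed[OF vk] normal_imp_subgroup[OF derived_normal]] u(2) by metis
    then obtain m where "m \<in> ?M" "v k [^] (1 + D * j) = m \<otimes> u" by (auto simp: r_coset_def)
    with k u show ?thesis by blast
  qed
  note ex = this
  show ?thesis
  proof (rule exI[of _ N], rule conjI[OF N(1)], intro allI impI)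
  qed (rule ex)
qed

text \<open>By assumption u and u' commute with each other and with a and b.  Hence the two powers
  commute with each other and with the commutator of a and b, which is then trivial by rigidity.\<close>

lemma commutes_if_powers_redundant:
  assumes abelian: "\<And>x y. x \<in> derived G (carrier G) \<Longrightarrow> y \<in> derived G (carrier G) \<Longrightarrow> x \<otimes> y = y \<otimes> x"
    and D1: "\<And>x j. x \<in> derived G (carrier G) \<Longrightarrow> x [^] (1 + D * j :: nat) = \<one> \<Longrightarrow> x = \<one>"
    and D2: "\<And>x j q. x \<in> derived G (carrier G) \<Longrightarrow> q \<in> carrier G \<Longrightarrow>
      commutes (q [^] (1 + D * j :: nat)) x \<Longrightarrow> commutes q x"
    and a: "a \<in> carrier G" and b: "b \<in> carrier G"
    and m: "m \<in> derived G (carrier G)" "m' \<in> derived G (carrier G)"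
    and an: "a [^] (1 + D * i) = m \<otimes> u" and bn: "b [^] (1 + D * j) = m' \<otimes> u'"
    and u: "commutes u a" "commutes u b" and u': "commutes u' a" "commutes u' b" "commutes u u'"
  shows "a \<otimes> b = b \<otimes> a"
proof -
  let ?M = "derived G (carrier G)"
  have M: "commutes x y" if "x \<in> ?M" "y \<in> ?M" for x y
    using abelian[OF that] that derived_carrier by (simp add: commutes_def)
  have mc: "m \<in> carrier G" "m' \<in> carrier G" using m derived_carrier by auto
  have uc: "u \<in> carrier G" "u' \<in> carrier G" using u(1) u'(1) commutes_closed by blast+
  define x where "x = a \<otimes> b \<otimes> inv a \<otimes> inv b"
  have x: "x \<in> ?M" unfolding x_def by (rule derived_set_closed_commutator[OF a b])
  have "commutes w x" if "commutes w a" "commutes w b" for w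
    unfolding x_def by (intro commutes_mult commutes_inv that)
  then have ux: "commutes x u" "commutes x u'" using u u' commutes_sym by blast+
  have "commutes (a [^] (1 + D * i)) x"
    unfolding an by (rule commutes_sym, rule commutes_mult[OF M[OF x m(1)] ux(1)])
  then have xa: "commutes x a" by (rule commutes_sym[OF D2[OF x a]])
  have "commutes (b [^] (1 + D * j)) x"
    unfolding bn by (rule commutes_sym, rule commutes_mult[OF M[OF x m(2)] ux(2)])
  then have xb: "commutes x b" by (rule commutes_sym[OF D2[OF x b]])
  have m': "m' = b [^] (1 + D * j) \<otimes> inv u'"
    unfolding bn using mc uc by (simp add: m_assoc)
  have "commutes u m'"
    unfolding m' by (intro commutes_mult commutes_inv commutes_pow u(2) u'(3))
  then have "commutes (a [^] (1 + D * i)) m'"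
    unfolding an by (rule commutes_sym[OF commutes_mult[OF M[OF m(2,1)] commutes_sym]])
  moreover have "commutes (a [^] (1 + D * i)) u'"
    by (rule commutes_sym[OF commutes_pow[OF u'(1)]])
  ultimately have "commutes (a [^] (1 + D * i)) (b [^] (1 + D * j))"
    unfolding bn by (rule commutes_mult)
  moreover have "a [^] (1 + D * i) \<otimes> b [^] (1 + D * j) =
      x [^] ((1 + D * i) * (1 + D * j)) \<otimes> b [^] (1 + D * j) \<otimes> a [^] (1 + D * i)"
    by (rule central_commutator_power[OF a b xa xb]) (unfold x_def, rule commutator_swap[OF a b])
  moreover have xc: "x \<in> carrier G" by (rule derived_carrier[OF x])
  ultimately have "x [^] ((1 + D * i) * (1 + D * j)) = \<one>"
    using r_cancel_one[of "b [^] (1 + D * j) \<otimes> a [^] (1 + D * i)" "x [^] ((1 + D * i) * (1 + D * j))"] a b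
    by (simp only: commutes_def m_assoc nat_pow_closed m_closed)
  also have "(1 + D * i) * (1 + D * j) = 1 + D * (i + j + D * i * j)"
    by (simp add: algebra_simps)
  finally have "x = \<one>" by (rule D1[OF x])
  then show ?thesis using commutator_swap[OF a b] a b by (simp add: x_def)
qed

text \<open>N * N pairs are arranged in N blocks. Redundancy among the a's of each block selects an
  index there, and redundancy among the b's at the selected indices selects a block. Then u involves
  only other a's of that block and u' only b's from other blocks, so the two index sets are disjoint
  and avoid the chosen pair.\<close>

lemma metabelian_commuting_pairs:
  assumes abelian: "\<And>x y. x \<in> derived G (carrier G) \<Longrightarrow> y \<in> derived G (carrier G) \<Longrightarrow> x \<otimes> y = y \<otimes> x"
    and Y: "finite Y" "Y \<subseteq> carrier G" "generate G Y = carrier G"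
  shows "\<exists>N :: nat. N \<ge> 1 \<and> (\<forall>a b. (\<forall>i<N. a i \<in> carrier G \<and> b i \<in> carrier G) \<longrightarrow>
    (\<forall>i<N. \<forall>j<N. i \<noteq> j \<longrightarrow> commutes (a i) (a j) \<and> commutes (a i) (b j) \<and> commutes (b i) (b j)) \<longrightarrow>
    (\<exists>k<N. a k \<otimes> b k = b k \<otimes> a k))"
proof -
  obtain D :: nat where D: "D \<ge> 2"
    and D1: "\<And>x j. x \<in> derived G (carrier G) \<Longrightarrow> x [^] (1 + D * j) = \<one> \<Longrightarrow> x = \<one>"
    and D2: "\<And>x j q. x \<in> derived G (carrier G) \<Longrightarrow> q \<in> carrier G \<Longrightarrow>
      commutes (q [^] (1 + D * j)) x \<Longrightarrow> commutes q x"
    using metabelian_rigidity[OF abelian Y] by metis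
  obtain N :: nat where N: "N \<ge> 1" "\<And>v. \<forall>l<N. v l \<in> carrier G \<Longrightarrow>
    (\<exists>k<N. \<exists>j :: nat. \<exists>m \<in> derived G (carrier G). \<exists>u \<in> generate G (v ` ({..<N} - {k})).
      v k [^] (1 + D * j) = m \<otimes> u)"
    using redundant_mod_derived[OF Y D] by blast
  have "\<exists>k<N * N. a k \<otimes> b k = b k \<otimes> a k"
    if closed: "\<forall>i<N * N. a i \<in> carrier G \<and> b i \<in> carrier G"
      and comm: "\<forall>i<N * N. \<forall>j<N * N. i \<noteq> j \<longrightarrow>
        commutes (a i) (a j) \<and> commutes (a i) (b j) \<and> commutes (b i) (b j)" for a b
  proof -
    have index: "q * N + l < N * N" if "q < N" "l < N" for q l
    proof -
      have "q * N + l < Suc q * N" using that by simp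
      also have "\<dots> \<le> N * N" using that by (intro mult_le_mono1) simp
      finally show ?thesis .
    qed
    have "\<exists>k<N. \<exists>j :: nat. \<exists>m \<in> derived G (carrier G).
        \<exists>u \<in> generate G ((\<lambda>l. a (q * N + l)) ` ({..<N} - {k})). a (q * N + k) [^] (1 + D * j) = m \<otimes> u"
      if "q < N" for q
      using N(2)[of "\<lambda>l. a (q * N + l)"] closed index[OF that] by blast
    then obtain \<kappa> i m u where \<kappa>: "\<And>q. q < N \<Longrightarrow> \<kappa> q < N"
      and m: "\<And>q. q < N \<Longrightarrow> m q \<in> derived G (carrier G)"
      and u: "\<And>q. q < N \<Longrightarrow> u q \<in> generate G ((\<lambda>l. a (q * N + l)) ` ({..<N} - {\<kappa> q}))"
      and an: "\<And>q. q < N \<Longrightarrow> a (q * N + \<kappa> q) [^] (1 + D * i q :: nat) = m q \<otimes> u q"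
      by metis
    define t where "t q = q * N + \<kappa> q" for q
    have t: "t q < N * N" if "q < N" for q unfolding t_def by (rule index[OF that \<kappa>[OF that]])
    have "\<exists>q<N. \<exists>j :: nat. \<exists>m' \<in> derived G (carrier G).
        \<exists>u' \<in> generate G ((\<lambda>l. b (t l)) ` ({..<N} - {q})). b (t q) [^] (1 + D * j) = m' \<otimes> u'"
      using N(2)[of "\<lambda>l. b (t l)"] closed t by blast
    then obtain q and j :: nat and m' u' where q: "q < N" and m': "m' \<in> derived G (carrier G)"
      and u': "u' \<in> generate G ((\<lambda>l. b (t l)) ` ({..<N} - {q}))"
      and bn: "b (t q) [^] (1 + D * j) = m' \<otimes> u'"
      by blast
    have u_comm: "commutes x (u q)"
      if "x \<in> carrier G" "\<And>l. l < N \<Longrightarrow> l \<noteq> \<kappa> q \<Longrightarrow> commutes x (a (q * N + l))" for x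
      by (rule commutes_generate[OF u[OF q] that(1)]) (use that(2) in auto)
    have u'_comm: "commutes x u'"
      if "x \<in> carrier G" "\<And>l. l < N \<Longrightarrow> l \<noteq> q \<Longrightarrow> commutes x (b (t l))" for x
      by (rule commutes_generate[OF u' that(1)]) (use that(2) in auto)
    \<comment> \<open>Quotient and remainder by N recover block and position, so the indices behind
      u and u' cannot collide.\<close>
    have block: "q * N + l \<noteq> t q'" if "l < N" "q' < N" "q' \<noteq> q \<or> l \<noteq> \<kappa> q" for l q'
    proof
      assume eq: "q * N + l = t q'"
      have "(q * N + l) div N = q" "(q * N + l) mod N = l" using block_index[OF that(1)] by blast+
      moreover have "(q' * N + \<kappa> q') div N = q'" "(q' * N + \<kappa> q') mod N = \<kappa> q'"
        using block_index[OF \<kappa>[OF that(2)]] by blast+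
      ultimately show False using eq that(3) unfolding t_def by metis
    qed
    have cq: "a (t q) \<in> carrier G" "b (t q) \<in> carrier G" using closed t[OF q] by auto
    have aa: "commutes (a i) (a j)" and ab: "commutes (a i) (b j)" and ba: "commutes (b j) (a i)"
      and bb: "commutes (b i) (b j)"
      if "i < N * N" "j < N * N" "i \<noteq> j" for i j
      using comm that commutes_sym by simp_all
    have tq: "t q \<noteq> t l" if "l < N" "l \<noteq> q" for l
      using block[OF \<kappa>[OF q] that(1)] that(2) unfolding t_def by metis
    have 1: "commutes (a (t q)) u'" "commutes (b (t q)) u'"
      by (intro u'_comm cq ab bb t q tq; assumption)+
    have tl: "t q \<noteq> q * N + l" "q * N + l \<noteq> t q" if "l < N" "l \<noteq> \<kappa> q" for l
      using block[OF that(1) q] that(2) by metis+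
    have 2: "commutes (a (t q)) (u q)" "commutes (b (t q)) (u q)"
      by (intro u_comm cq aa ba t q tl index; assumption)+
    \<comment> \<open>Every a of block q commutes with u', the chosen one included; hence so does
      u.\<close>
    have "commutes (a (q * N + l)) u'" if l: "l < N" for l
    proof (rule u'_comm)
      show "a (q * N + l) \<in> carrier G" using closed index[OF q l] by blast
      show "commutes (a (q * N + l)) (b (t l'))" if "l' < N" "l' \<noteq> q" for l'
        by (rule ab[OF index[OF q l] t[OF that(1)] block[OF l that(1)]]) (use that(2) in simp)
    qed
    then have 3: "commutes u' (u q)"
      by (intro u_comm commutes_sym[of _ u'] commutes_closed(2)[OF 1(1)])
    have "a (t q) \<otimes> b (t q) = b (t q) \<otimes> a (t q)"
      by (rule commutes_if_powers_redundant[OF abelian D1 D2 cq m[OF q] m'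
          an[OF q, folded t_def] bn 2[THEN commutes_sym] 1[THEN commutes_sym] 3[THEN commutes_sym]])
    then show ?thesis using t[OF q] by blast
  qed
  note ex = this
  show ?thesis
  proof (rule exI[of _ "N * N"], intro conjI allI impI)
    show "1 \<le> N * N" using N(1) by simp
  qed (rule ex)
qed

end

section \<open>Weak identities and verbal subgroups\<close>

text \<open>The quotient G/G'' is metabelian and finitely generated, and commuting elements keep
  commuting in it. Two elements whose images there commute have their commutator in G''.\<close>

lemma (in group) ex_commuting_derived:
  assumes Y: "finite Y" "Y \<subseteq> carrier G" "generate G Y = carrier G"
  shows "\<exists>N :: nat. N \<ge> 1 \<and> (\<forall>a b. (\<forall>i<N. a i \<in> carrier G \<and> b i \<in> carrier G) \<longrightarrow>
    (\<forall>i<N. \<forall>j<N. i \<noteq> j \<longrightarrow> commutes (a i) (a j) \<and> commutes (a i) (b j) \<and> commutes (b i) (b j)) \<longrightarrow>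
    (\<exists>k<N. a k \<otimes> b k \<otimes> inv (a k) \<otimes> inv (b k) \<in> derived G (derived G (carrier G))))"
proof -
  let ?K = "derived G (derived G (carrier G))"
  let ?Q = "G Mod ?K"
  let ?\<pi> = "(#>) ?K"
  have K: "?K \<lhd> G" by (rule derived_is_normal[OF derived_normal])
  interpret K: normal ?K G by (rule K)
  interpret \<pi>: group_hom G ?Q ?\<pi> by (rule group_hom_FactGroup[OF K])
  have in_K: "?\<pi> x = \<one>\<^bsub>?Q\<^esub> \<longleftrightarrow> x \<in> ?K" if "x \<in> carrier G" for x
    using that coset_join1[OF _ that K.subgroup_axioms] coset_join2[OF that K.subgroup_axioms]
      K.subset by auto
  have abelian: "x \<otimes>\<^bsub>?Q\<^esub> y = y \<otimes>\<^bsub>?Q\<^esub> x"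
    if "x \<in> derived ?Q (carrier ?Q)" "y \<in> derived ?Q (carrier ?Q)" for x y
  proof -
    have "carrier ?Q = ?\<pi> ` carrier G" by (simp add: carrier_FactGroup)
    then have D: "derived ?Q (carrier ?Q) = ?\<pi> ` derived G (carrier G)"
      using \<pi>.derived_img[of "carrier G"] by simp
    then obtain g h where g: "g \<in> derived G (carrier G)" "x = ?\<pi> g"
      and h: "h \<in> derived G (carrier G)" "y = ?\<pi> h" using \<open>x \<in> _\<close> \<open>y \<in> _\<close> by auto
    have gh: "g \<in> carrier G" "h \<in> carrier G" using g h derived_carrier by auto
    have "g \<otimes> h \<otimes> inv g \<otimes> inv h \<in> ?K"
      unfolding derived_def[of G "derived G (carrier G)"] using g h by (auto intro!: generate.incl)
    moreover have "g \<otimes> h \<otimes> inv g \<otimes> inv h \<in> carrier G" using gh by simp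
    ultimately have "?\<pi> (g \<otimes> h \<otimes> inv g \<otimes> inv h) = \<one>\<^bsub>?Q\<^esub>" using in_K by blast
    then have "x \<otimes>\<^bsub>?Q\<^esub> y \<otimes>\<^bsub>?Q\<^esub> inv\<^bsub>?Q\<^esub> x \<otimes>\<^bsub>?Q\<^esub> inv\<^bsub>?Q\<^esub> y = \<one>\<^bsub>?Q\<^esub>"
      using gh by (simp only: g(2) h(2) \<pi>.hom_mult \<pi>.hom_inv m_closed inv_closed)
    then show ?thesis
      using \<pi>.H.commutator_swap[of x y] gh \<pi>.hom_closed by (simp only: g(2) h(2) \<pi>.H.l_one)
  qed
  have \<pi>Y: "finite (?\<pi> ` Y)" "?\<pi> ` Y \<subseteq> carrier ?Q" "generate ?Q (?\<pi> ` Y) = carrier ?Q"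
    using Y by (auto simp: generate_FactGroup[OF K] carrier_FactGroup)
  obtain N :: nat where N: "N \<ge> 1" and commuting: "\<And>a b. \<forall>i<N. a i \<in> carrier ?Q \<and> b i \<in> carrier ?Q \<Longrightarrow>
    \<forall>i<N. \<forall>j<N. i \<noteq> j \<longrightarrow> \<pi>.H.commutes (a i) (a j) \<and> \<pi>.H.commutes (a i) (b j) \<and> \<pi>.H.commutes (b i) (b j) \<Longrightarrow>
    \<exists>k<N. a k \<otimes>\<^bsub>?Q\<^esub> b k = b k \<otimes>\<^bsub>?Q\<^esub> a k"
    using \<pi>.H.metabelian_commuting_pairs[OF abelian \<pi>Y] by blast
  have "\<exists>k<N. a k \<otimes> b k \<otimes> inv (a k) \<otimes> inv (b k) \<in> ?K"
    if closed: "\<forall>i<N. a i \<in> carrier G \<and> b i \<in> carrier G"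
      and comm: "\<forall>i<N. \<forall>j<N. i \<noteq> j \<longrightarrow>
        commutes (a i) (a j) \<and> commutes (a i) (b j) \<and> commutes (b i) (b j)" for a b
  proof -
    have \<pi>_comm: "\<pi>.H.commutes (?\<pi> x) (?\<pi> y)" if "commutes x y" for x y
      unfolding \<pi>.H.commutes_def using that \<pi>.hom_mult[of x y] \<pi>.hom_mult[of y x] \<pi>.hom_closed
      by (simp only: commutes_def)
    have "\<exists>k<N. ?\<pi> (a k) \<otimes>\<^bsub>?Q\<^esub> ?\<pi> (b k) = ?\<pi> (b k) \<otimes>\<^bsub>?Q\<^esub> ?\<pi> (a k)"
      by (rule commuting) (use closed comm \<pi>_comm \<pi>.hom_closed in blast)+
    then obtain k where k: "k < N" "?\<pi> (a k) \<otimes>\<^bsub>?Q\<^esub> ?\<pi> (b k) = ?\<pi> (b k) \<otimes>\<^bsub>?Q\<^esub> ?\<pi> (a k)" by blast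
    have c: "a k \<in> carrier G" "b k \<in> carrier G" using closed k(1) by auto
    then have c\<pi>: "?\<pi> (a k) \<in> carrier ?Q" "?\<pi> (b k) \<in> carrier ?Q" using \<pi>.hom_closed by auto
    have "?\<pi> (a k \<otimes> b k \<otimes> inv (a k) \<otimes> inv (b k)) =
        ?\<pi> (a k) \<otimes>\<^bsub>?Q\<^esub> ?\<pi> (b k) \<otimes>\<^bsub>?Q\<^esub> inv\<^bsub>?Q\<^esub> ?\<pi> (a k) \<otimes>\<^bsub>?Q\<^esub> inv\<^bsub>?Q\<^esub> ?\<pi> (b k)"
      using c by (simp only: \<pi>.hom_mult \<pi>.hom_inv m_closed inv_closed)
    also have "\<dots> = \<one>\<^bsub>?Q\<^esub>"
      unfolding k(2) using c\<pi> \<pi>.H.m_assoc \<pi>.H.r_inv \<pi>.H.r_one \<pi>.H.inv_closed \<pi>.H.m_closed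
      by (metis (no_types))
    finally have "a k \<otimes> b k \<otimes> inv (a k) \<otimes> inv (b k) \<in> ?K"
      using in_K c by (simp only: m_closed inv_closed)
    with k(1) show ?thesis by blast
  qed
  note ex = this
  show ?thesis
  proof (rule exI[of _ N], rule conjI[OF N], intro allI impI)
  qed (rule ex)
qed

section \<open>Direct powers of the free group and weak identities\<close>

lemma incl_hom:
  assumes "k < N"
  shows "incl N k \<in> hom freeF (freeF_pow N)"
proof (rule homI)
  fix x y assume "x \<in> carrier freeF" "y \<in> carrier freeF"
  then show "incl N k x \<in> carrier (freeF_pow N)"
    by (auto simp: incl_def freeF_pow_def carrier_freeF)
  show "incl N k (x \<otimes>\<^bsub>freeF\<^esub> y) = incl N k x \<otimes>\<^bsub>freeF_pow N\<^esub> incl N k y"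
    by (auto simp: incl_def freeF_pow_def mult_freeF fun_eq_iff)
qed

lemma incl_commute:
  assumes "x \<in> carrier freeF" "y \<in> carrier freeF" "i \<noteq> j"
  shows "incl N i x \<otimes>\<^bsub>freeF_pow N\<^esub> incl N j y = incl N j y \<otimes>\<^bsub>freeF_pow N\<^esub> incl N i x"
  using assms by (auto simp: incl_def freeF_pow_def mult_freeF carrier_freeF fun_eq_iff)

text \<open>The inclusion of H_k' in G'' accounts for the gap of one between the two indices; n
  further derivations of both sides reach the trivial group.\<close>

lemma (in group) weak_identities_derived:
  assumes Y: "finite Y" "Y \<subseteq> carrier G" "generate G Y = carrier G"
    and triv: "(derived G ^^ Suc (Suc n)) (carrier G) = {\<one>}"
  shows "weak_identities G ((derived freeF ^^ Suc n) (carrier freeF))"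
proof -
  let ?K = "derived G (derived G (carrier G))"
  obtain N :: nat where N: "N \<ge> 1" and commuting: "\<And>a b. \<forall>i<N. a i \<in> carrier G \<and> b i \<in> carrier G \<Longrightarrow>
    \<forall>i<N. \<forall>j<N. i \<noteq> j \<longrightarrow> commutes (a i) (a j) \<and> commutes (a i) (b j) \<and> commutes (b i) (b j) \<Longrightarrow>
    \<exists>k<N. a k \<otimes> b k \<otimes> inv (a k) \<otimes> inv (b k) \<in> ?K"
    using ex_commuting_derived[OF Y] by blast
  have K: "subgroup ?K G"
    by (rule normal_imp_subgroup[OF derived_is_normal[OF derived_normal]])
  have "\<exists>k<N. \<rho> (incl N k (s k)) = \<one>"
    if s: "s \<in> {..<N} \<rightarrow> (derived freeF ^^ Suc n) (carrier freeF)"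
      and \<rho>: "\<rho> \<in> hom (freeF_pow N) G" for s \<rho>
  proof -
    define \<sigma> where "\<sigma> k = \<rho> \<circ> incl N k" for k
    have \<sigma>: "\<sigma> k \<in> hom freeF G" if "k < N" for k
      unfolding \<sigma>_def by (rule Group.hom_compose[OF incl_hom[OF that] \<rho>])
    have \<sigma>_comm: "commutes (\<sigma> i x) (\<sigma> j y)"
      if "i < N" "j < N" "i \<noteq> j" "x \<in> carrier freeF" "y \<in> carrier freeF" for i j x y
    proof -
      have "incl N i x \<in> carrier (freeF_pow N)" "incl N j y \<in> carrier (freeF_pow N)"
        using hom_in_carrier[OF incl_hom] that by auto
      then show ?thesis
        using hom_mult[OF \<rho>] incl_commute[OF that(4,5,3), of N] hom_in_carrier[OF \<rho>]
        unfolding commutes_def \<sigma>_def comp_def by metis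
    qed
    \<comment> \<open>From pairs to subgroups: if every factor violated the inclusion, choosing one
      violating pair in each would contradict the statement about N pairs.\<close>
    have "\<exists>k<N. \<forall>x\<in>carrier freeF. \<forall>y\<in>carrier freeF.
        \<sigma> k x \<otimes> \<sigma> k y \<otimes> inv (\<sigma> k x) \<otimes> inv (\<sigma> k y) \<in> ?K"
    proof (rule ccontr)
      assume "\<not> ?thesis"
      then have "\<forall>k. \<exists>x y. k < N \<longrightarrow> x \<in> carrier freeF \<and> y \<in> carrier freeF \<and>
        \<sigma> k x \<otimes> \<sigma> k y \<otimes> inv (\<sigma> k x) \<otimes> inv (\<sigma> k y) \<notin> ?K" by blast
      then obtain x y where xy: "\<And>k. k < N \<Longrightarrow> x k \<in> carrier freeF" "\<And>k. k < N \<Longrightarrow> y k \<in> carrier freeF"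
        and notin: "\<And>k. k < N \<Longrightarrow> \<sigma> k (x k) \<otimes> \<sigma> k (y k) \<otimes> inv (\<sigma> k (x k)) \<otimes> inv (\<sigma> k (y k)) \<notin> ?K"
        by metis
      have "\<exists>k<N. \<sigma> k (x k) \<otimes> \<sigma> k (y k) \<otimes> inv (\<sigma> k (x k)) \<otimes> inv (\<sigma> k (y k)) \<in> ?K"
        by (rule commuting) (use xy hom_in_carrier[OF \<sigma>] \<sigma>_comm in auto)
      with notin show False by blast
    qed
    then obtain k where k: "k < N" and comm: "\<And>x y. x \<in> carrier freeF \<Longrightarrow> y \<in> carrier freeF \<Longrightarrow>
        \<sigma> k x \<otimes> \<sigma> k y \<otimes> inv (\<sigma> k x) \<otimes> inv (\<sigma> k y) \<in> ?K" by blast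
    interpret S: group_hom freeF G "\<sigma> k"
      by (intro group_hom.intro group_hom_axioms.intro group_freeF group_axioms \<sigma>[OF k])
    have "derived G (\<sigma> k ` carrier freeF) \<subseteq> ?K"
      unfolding derived_def[of G "\<sigma> k ` carrier freeF"]
      by (rule generate_subgroup_incl[OF _ K]) (use comm in auto)
    then have "(derived G ^^ n) (derived G (\<sigma> k ` carrier freeF)) \<subseteq> (derived G ^^ n) ?K"
      by (rule mono_exp_of_derived)
    also have "\<dots> = {\<one>}" using triv by (simp add: funpow_swap1)
    finally have "(derived G ^^ Suc n) (\<sigma> k ` carrier freeF) \<subseteq> {\<one>}" by (simp add: funpow_swap1)
    then have "\<sigma> k ` (derived freeF ^^ Suc n) (carrier freeF) \<subseteq> {\<one>}"
      using S.exp_of_derived_img[OF subset_refl, of "Suc n"] by simp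
    moreover have "s k \<in> (derived freeF ^^ Suc n) (carrier freeF)" using s k by blast
    ultimately have "\<sigma> k (s k) = \<one>" by blast
    with k show ?thesis unfolding \<sigma>_def comp_def by blast
  qed
  then show ?thesis unfolding weak_identities_def using N by blast
qed

text \<open>\<open>verbal\<close> collects values of words, not products of values. Two values
  become values under a single homomorphism once endomorphisms, which preserve H, have moved the
  words to disjoint generators. Conjugates arise by composing with an inner automorphism.\<close>

lemma (in group) verbal_normal:
  assumes H: "T_subgroup H"
  shows "verbal H G \<lhd> G"
proof -
  have sH: "subgroup H freeF" and endo: "\<And>\<phi> h. \<phi> \<in> hom freeF freeF \<Longrightarrow> h \<in> H \<Longrightarrow> \<phi> h \<in> H"
    using H by (auto simp: T_subgroup_def)
  interpret H: subgroup H freeF by (rule sH)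
  have Hc: "h \<in> carrier freeF" if "h \<in> H" for h using that by (rule H.mem_carrier)
  have hom: "group_hom freeF G \<pi>" if "\<pi> \<in> hom freeF G" for \<pi>
    by (intro group_hom.intro group_hom_axioms.intro group_freeF group_axioms that)
  have "subgroup (verbal H G) G"
  proof (rule subgroupI)
    show "verbal H G \<subseteq> carrier G" using hom_in_carrier Hc by (fastforce simp: verbal_def)
    have "eval_word G (\<lambda>_. \<one>) \<in> hom freeF G" by (rule eval_word_hom) auto
    then show "verbal H G \<noteq> {}" using H.one_closed unfolding verbal_def by blast
  next
    fix x assume "x \<in> verbal H G"
    then obtain h \<pi> where x: "x = \<pi> h" "h \<in> H" "\<pi> \<in> hom freeF G" by (auto simp: verbal_def)
    then have "inv x = \<pi> (inv\<^bsub>freeF\<^esub> h)" using group_hom.hom_inv[OF hom[OF x(3)] Hc[OF x(2)]] by simp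
    then show "inv x \<in> verbal H G" using x H.m_inv_closed unfolding verbal_def by blast
  next
    fix x y assume "x \<in> verbal H G" "y \<in> verbal H G"
    then obtain h p h' q where x: "x = p h" "h \<in> H" "p \<in> hom freeF G"
      and y: "y = q h'" "h' \<in> H" "q \<in> hom freeF G" by (auto simp: verbal_def)
    obtain \<phi> \<psi> \<pi> where \<phi>: "\<phi> \<in> hom freeF freeF" and \<psi>: "\<psi> \<in> hom freeF freeF"
      and \<pi>: "\<pi> \<in> hom freeF G"
      and eq: "\<And>w. w \<in> carrier freeF \<Longrightarrow> \<pi> (\<phi> w) = p w" "\<And>w. w \<in> carrier freeF \<Longrightarrow> \<pi> (\<psi> w) = q w"
      using freeF_join[OF group_axioms x(3) y(3)] by blast
    have in_H: "\<phi> h \<in> H" "\<psi> h' \<in> H" using endo \<phi> \<psi> x y by auto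
    have "x \<otimes> y = \<pi> (\<phi> h \<otimes>\<^bsub>freeF\<^esub> \<psi> h')"
      using hom_mult[OF \<pi> Hc[OF in_H(1)] Hc[OF in_H(2)]] eq x(1,2) y(1,2) Hc by simp
    then show "x \<otimes> y \<in> verbal H G" using H.m_closed[OF in_H] \<pi> unfolding verbal_def by blast
  qed
  moreover have "g \<otimes> x \<otimes> inv g \<in> verbal H G" if g: "g \<in> carrier G" and "x \<in> verbal H G" for g x
  proof -
    obtain h \<pi> where x: "x = \<pi> h" "h \<in> H" "\<pi> \<in> hom freeF G"
      using \<open>x \<in> verbal H G\<close> by (auto simp: verbal_def)
    have "(\<lambda>x. g \<otimes> x \<otimes> inv g) \<in> hom G G"
      using g by (auto simp: hom_def m_assoc inv_cancel)
    then have "(\<lambda>x. g \<otimes> x \<otimes> inv g) \<circ> \<pi> \<in> hom freeF G" by (rule Group.hom_compose[OF x(3)])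
    moreover have "g \<otimes> x \<otimes> inv g = ((\<lambda>x. g \<otimes> x \<otimes> inv g) \<circ> \<pi>) h" by (simp add: x(1))
    ultimately show ?thesis using x(2) unfolding verbal_def by blast
  qed
  ultimately show ?thesis by (simp add: normal_inv_iff)
qed

text \<open>The derived series commutes with homomorphic images and is monotone, so endomorphisms
  respect it.\<close>

lemma T_subgroup_derived: "T_subgroup ((derived freeF ^^ n) (carrier freeF))"
proof -
  interpret F: group freeF by (rule group_freeF)
  have "\<phi> ` (derived freeF ^^ n) (carrier freeF) \<subseteq> (derived freeF ^^ n) (carrier freeF)"
    if \<phi>: "\<phi> \<in> hom freeF freeF" for \<phi>
  proof -
    interpret group_hom freeF freeF \<phi>
      by (intro group_hom.intro group_hom_axioms.intro group_freeF \<phi>)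
    have "\<phi> ` (derived freeF ^^ n) (carrier freeF) = (derived freeF ^^ n) (\<phi> ` carrier freeF)"
      by (rule exp_of_derived_img[OF subset_refl, symmetric])
    also have "\<dots> \<subseteq> (derived freeF ^^ n) (carrier freeF)"
      using hom_carrier[OF \<phi>] by (rule F.mono_exp_of_derived)
    finally show ?thesis .
  qed
  then show ?thesis
    by (simp add: T_subgroup_def F.exp_of_derived_is_subgroup F.subgroup_self)
qed

lemma T_subgroup_trivial: "T_subgroup {[]}"
proof -
  have "\<phi> [] = []" if "\<phi> \<in> hom freeF freeF" for \<phi>
    using hom_one[OF that group_freeF group_freeF] by (simp add: one_freeF)
  then show ?thesis
    using group.triv_subgroup[OF group_freeF] by (simp add: T_subgroup_def one_freeF)
qed

text \<open>Bounds the derived length of the quotient by a verbal subgroup. A commutator of two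
  values is a value of the commutator of two words in disjoint generators, and values of a
  T-subgroup are closed under products.\<close>

lemma (in group) derived_subset_verbal:
  "(derived G ^^ n) (carrier G) \<subseteq> verbal ((derived freeF ^^ n) (carrier freeF)) G"
proof (induction n)
  case 0
  show ?case
  proof
    fix g assume "g \<in> (derived G ^^ 0) (carrier G)"
    then have g: "range (\<lambda>_ :: nat. g) \<subseteq> carrier G" by auto
    then have "g = eval_word G (\<lambda>_. g) (gen 0)" by (simp add: eval_word_gen)
    then show "g \<in> verbal ((derived freeF ^^ 0) (carrier freeF)) G"
      unfolding verbal_def funpow_0 mem_Collect_eq using eval_word_hom[OF g] gen_in_carrier by blast
  qed
next
  case (Suc n)
  interpret F: group freeF by (rule group_freeF)
  let ?H = "(derived freeF ^^ n) (carrier freeF)"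
  have T: "\<And>m. subgroup ((derived freeF ^^ m) (carrier freeF)) freeF"
    "\<And>\<phi> h. \<phi> \<in> hom freeF freeF \<Longrightarrow> h \<in> ?H \<Longrightarrow> \<phi> h \<in> ?H"
    using T_subgroup_derived by (auto simp: T_subgroup_def)
  have Hc: "h \<in> carrier freeF" if "h \<in> ?H" for h using subgroup.mem_carrier[OF T(1) that] .
  have "x \<otimes> y \<otimes> inv x \<otimes> inv y \<in> verbal (derived freeF ?H) G"
    if "x \<in> (derived G ^^ n) (carrier G)" "y \<in> (derived G ^^ n) (carrier G)" for x y
  proof -
    have "x \<in> verbal ?H G" "y \<in> verbal ?H G" using Suc that by auto
    then obtain h p h' q where x: "x = p h" "h \<in> ?H" "p \<in> hom freeF G"
      and y: "y = q h'" "h' \<in> ?H" "q \<in> hom freeF G" unfolding verbal_def by blast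
    obtain \<phi> \<psi> \<pi> where \<phi>: "\<phi> \<in> hom freeF freeF" and \<psi>: "\<psi> \<in> hom freeF freeF"
      and \<pi>: "\<pi> \<in> hom freeF G"
      and eq: "\<And>w. w \<in> carrier freeF \<Longrightarrow> \<pi> (\<phi> w) = p w" "\<And>w. w \<in> carrier freeF \<Longrightarrow> \<pi> (\<psi> w) = q w"
      using freeF_join[OF group_axioms x(3) y(3)] by blast
    interpret P: group_hom freeF G \<pi>
      by (intro group_hom.intro group_hom_axioms.intro group_freeF group_axioms \<pi>)
    have H: "\<phi> h \<in> ?H" "\<psi> h' \<in> ?H" using T(2) \<phi> \<psi> x(2) y(2) by auto
    let ?c = "\<phi> h \<otimes>\<^bsub>freeF\<^esub> \<psi> h' \<otimes>\<^bsub>freeF\<^esub> inv\<^bsub>freeF\<^esub> \<phi> h \<otimes>\<^bsub>freeF\<^esub> inv\<^bsub>freeF\<^esub> \<psi> h'"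
    have "?c \<in> derived freeF ?H"
      unfolding derived_def[of freeF ?H] using H by (auto intro!: generate.incl)
    moreover have "x \<otimes> y \<otimes> inv x \<otimes> inv y = \<pi> ?c"
      using Hc[OF H(1)] Hc[OF H(2)] eq(1)[OF Hc[OF x(2)]] eq(2)[OF Hc[OF y(2)]] x(1) y(1) by simp
    ultimately show ?thesis using \<pi> unfolding verbal_def by blast
  qed
  then have "derived_set G ((derived G ^^ n) (carrier G)) \<subseteq> verbal (derived freeF ?H) G"
    by blast
  then have "derived G ((derived G ^^ n) (carrier G)) \<subseteq> verbal (derived freeF ?H) G"
    unfolding derived_def[of G] using verbal_normal[OF T_subgroup_derived[of "Suc n"]]
    by (intro generate_subgroup_incl normal_imp_subgroup) simp_all
  then show ?case by simp
qed

theorem theorem5p9: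
  fixes G :: "('a, 'b) monoid_scheme"
  assumes "group G" and "finitely_generated G" and "solvable G"
  shows "weak_star_identities_mod G {[]} (derived freeF (carrier freeF))"
proof -
  interpret group G by (rule assms(1))
  let ?F = "\<lambda>n. (derived freeF ^^ n) (carrier freeF)"
  obtain Y where Y: "finite Y" "Y \<subseteq> carrier G" "generate G Y = carrier G"
    using assms(2) by (auto simp: finitely_generated_def)
  obtain m where m: "(derived G ^^ m) (carrier G) = {\<one>\<^bsub>G\<^esub>}"
    using assms(3) solvable_iff_trivial_derived_seq by blast
  have triv: "(derived G ^^ n) {\<one>\<^bsub>G\<^esub>} \<subseteq> {\<one>\<^bsub>G\<^esub>}" for n
  proof (induction n)
    case (Suc n)
    then show ?case using derived_incl[OF _ triv_subgroup] by simp
  qed simp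
  \<comment> \<open>The bound is \<open>Suc m\<close> instead of \<open>m\<close> so that
    \<open>S 0\<close> is F' even for m = 0. In the final step, from F^(m+1) to the trivial
    subgroup, the required triviality of G^(m+2) follows from that of G^(m).\<close>
  define S where "S i = (if i < Suc m then ?F (Suc i) else {[]})" for i
  have T: "T_subgroup (S i)" for i
    unfolding S_def using T_subgroup_derived T_subgroup_trivial by presburger
  have "weak_identities (G Mod verbal (S (Suc j)) G) (S j)" if j: "j < Suc m" for j
  proof -
    let ?V = "verbal (S (Suc j)) G"
    have V: "?V \<lhd> G" by (rule verbal_normal[OF T])
    have sub: "(derived G ^^ Suc (Suc j)) (carrier G) \<subseteq> ?V"
    \<comment> \<open>Before the end of the chain G^(j+2) consists of values of F^(j+2). At the end
      j = m, and the solvability of G takes over.\<close>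
    proof (cases "Suc j < Suc m")
      case True
      then show ?thesis using derived_subset_verbal[of "Suc (Suc j)"] by (simp add: S_def)
    next
      case False
      then have "Suc (Suc j) = (Suc (Suc j) - m) + m" by simp
      then have "(derived G ^^ Suc (Suc j)) (carrier G)
          = (derived G ^^ (Suc (Suc j) - m)) ((derived G ^^ m) (carrier G))"
        by (metis comp_apply funpow_add)
      also have "\<dots> \<subseteq> {\<one>\<^bsub>G\<^esub>}" unfolding m by (rule triv)
      also have "\<dots> \<subseteq> ?V" using subgroup.one_closed[OF normal_imp_subgroup[OF V]] by simp
      finally show ?thesis .
    qed
    let ?\<pi> = "r_coset G ?V"
    interpret \<pi>: group_hom G "G Mod ?V" ?\<pi> by (rule group_hom_FactGroup[OF V])
    have "carrier (G Mod ?V) = ?\<pi> ` carrier G" by (simp add: carrier_FactGroup)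
    then have "(derived (G Mod ?V) ^^ Suc (Suc j)) (carrier (G Mod ?V))
        = ?\<pi> ` (derived G ^^ Suc (Suc j)) (carrier G)"
      by (simp only: \<pi>.exp_of_derived_img[OF subset_refl])
    also have "\<dots> \<subseteq> {\<one>\<^bsub>G Mod ?V\<^esub>}"
    proof (rule image_subsetI)
      fix x assume "x \<in> (derived G ^^ Suc (Suc j)) (carrier G)"
      with sub have x: "x \<in> ?V" ..
      show "?\<pi> x \<in> {\<one>\<^bsub>G Mod ?V\<^esub>}"
        using coset_join2[OF subgroup.mem_carrier[OF normal_imp_subgroup[OF V] x] normal_imp_subgroup[OF V] x]
        by simp
    qed
    finally have "(derived (G Mod ?V) ^^ Suc (Suc j)) (carrier (G Mod ?V)) \<subseteq> {\<one>\<^bsub>G Mod ?V\<^esub>}" .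
    moreover have "\<one>\<^bsub>G Mod ?V\<^esub> \<in> (derived (G Mod ?V) ^^ Suc (Suc j)) (carrier (G Mod ?V))"
      by (rule subgroup.one_closed[OF \<pi>.H.exp_of_derived_is_subgroup[OF \<pi>.H.subgroup_self]])
    ultimately have *: "(derived (G Mod ?V) ^^ Suc (Suc j)) (carrier (G Mod ?V)) = {\<one>\<^bsub>G Mod ?V\<^esub>}"
      by blast
    have "finite (?\<pi> ` Y)" "?\<pi> ` Y \<subseteq> carrier (G Mod ?V)"
      "generate (G Mod ?V) (?\<pi> ` Y) = carrier (G Mod ?V)"
      using Y by (auto simp: generate_FactGroup[OF V] carrier_FactGroup)
    from \<pi>.H.weak_identities_derived[OF this *] show ?thesis using j by (simp add: S_def)
  qed
  note weak = this
  have "\<forall>j\<in>{1..Suc m}. weak_identities_mod G (S j) (S (j - 1))"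
  proof
    fix j assume "j \<in> {1..Suc m}"
    then have "Suc (j - 1) = j" "j - 1 < Suc m" by auto
    with weak[of "j - 1"] show "weak_identities_mod G (S j) (S (j - 1))"
      by (simp only: weak_identities_mod_def)
  qed
  moreover have "S 0 = derived freeF (carrier freeF)" "S (Suc m) = {[]}" by (simp_all add: S_def)
  ultimately show ?thesis unfolding weak_star_identities_mod_def using T by blast
qed

end
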